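(* Let $G$ act by isometries on a Gromov hyperbolic space $X$, and suppose $h_1,\dots,h_k$ ($k\ge 1$) are independent loxodromic WPD elements with respect to this action. There exists a constant $D\ge1$ such that for any integers $d_1,\dots,d_k\ge D$, if $H=\langle h_1^{d_1},\dots,h_k^{d_k}\rangle$, then $(G,X,H)$ is an A/QI triple. In particular, every non-trivial element of $H$ is a loxodromic WPD element with respect to the action of $G$ on $X$.
   Context: A hyperbolic space is a Gromov hyperbolic geodesic metric space $(X,d)$; all actions are by isometries. An isometry $g$ is loxodromic if $n\mapsto g^nx$ is a quasi-isometric embedding $\mathbb Z\to X$; it then has exactly two fixed points in $\partial X$. Loxodromic isometries are independent if their fixed point sets in $\partial X$ are (pairwise) disjoint. A loxodromic element $g\in G$ is a WPD element (with respect to $X$) if for every $x\in X$ and every $\varepsilon\ge0$ there exists $N>0$ such that $\{\gamma\in G\mid d(x,\gamma x)\le\varepsilon\text{ and }d(g^Nx,\gamma g^Nx)\le\varepsilon\}$ is finite. For $Y\subseteq X$, an action $G\curvearrowright X$ is acylindrical along $Y$ if for every $\varepsilon\ge 0$ there are $R>0$ and $M>0$ so that, whenever $x,y\in Y$ satisfy $d(x,y)\ge R$, $\#\{g\in G\mid d(gx,x)\le\varepsilon \text{ and } d(gy,y)\le\varepsilon\}\le M$. For $H<G$, the action is acylindrical along $H$ if it is acylindrical along $Hx$ for some (equivalently any) $x\in X$. A finitely generated subgroup $H<G$ is quasi-isometrically embedded by the action if, for some (equivalently any) $x\in X$, $h\mapsto hx$ is a quasi-isometric embedding of $H$ (with a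 word metric) into $X$. An A/QI triple $(G,X,H)$ consists of a hyperbolic space $X$ and an action $G\curvearrowright X$ which is acylindrical along a finitely generated infinite subgroup $H<G$ that is quasi-isometrically embedded by the action. *)

theory Defs
  imports Complex_Main "HOL-Algebra.Generated_Groups" "HOL-Algebra.Group_Action"
begin

section \<open>Hyperbolic spaces and their boundary\<close>

definition geodesic_space :: "'x::metric_space itself \<Rightarrow> bool" where
  "geodesic_space _ \<longleftrightarrow>
     (\<forall>x y :: 'x. \<exists>c :: real \<Rightarrow> 'x. c 0 = x \<and> c (dist x y) = y \<and>
        (\<forall>s\<in>{0..dist x y}. \<forall>t\<in>{0..dist x y}. dist (c s) (c t) = \<bar>s - t\<bar>))"

definition gromov_product :: "'x::metric_space \<Rightarrow> 'x \<Rightarrow> 'x \<Rightarrow> real" where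
  "gromov_product w x y = (dist x w + dist y w - dist x y) / 2"

definition gromov_hyperbolic :: "'x::metric_space itself \<Rightarrow> bool" where
  "gromov_hyperbolic _ \<longleftrightarrow>
     (\<exists>\<delta>\<ge>0. \<forall>w x y z :: 'x.
        gromov_product w x z \<ge> min (gromov_product w x y) (gromov_product w y z) - \<delta>)"

definition hyperbolic_space :: "'x::metric_space itself \<Rightarrow> bool" where
  "hyperbolic_space T \<longleftrightarrow> geodesic_space T \<and> gromov_hyperbolic T"

text \<open>The space is not assumed proper, so the boundary is the sequential one: classes of
  sequences converging to infinity. Gromov products with respect to two basepoints differ by
  at most the distance of the basepoints, so the quantifier over \<open>w\<close> could equally be existential.\<close>

definition converges_to_infinity :: "(nat \<Rightarrow> 'x::metric_space) \<Rightarrow> bool" where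
  "converges_to_infinity u \<longleftrightarrow>
     (\<forall>w. filterlim (\<lambda>(m, n). gromov_product w (u m) (u n)) at_top
            (sequentially \<times>\<^sub>F sequentially))"

definition boundary_rel :: "((nat \<Rightarrow> 'x::metric_space) \<times> (nat \<Rightarrow> 'x)) set" where
  "boundary_rel = {(u, v). converges_to_infinity u \<and> converges_to_infinity v \<and>
     (\<forall>w. filterlim (\<lambda>n. gromov_product w (u n) (v n)) at_top sequentially)}"

definition gromov_boundary :: "(nat \<Rightarrow> 'x::metric_space) set set" where
  "gromov_boundary = {u. converges_to_infinity u} // boundary_rel"

text \<open>A bijective isometry \<open>f\<close> acts on boundary points, which are sets of sequences,
  by taking the image under postcomposition with \<open>f\<close>.\<close>

definition boundary_fixed_points ::
    "('x::metric_space \<Rightarrow> 'x) \<Rightarrow> (nat \<Rightarrow> 'x) set set" where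
  "boundary_fixed_points f = {\<xi> \<in> gromov_boundary. (\<lambda>u. f \<circ> u) ` \<xi> = \<xi>}"

text \<open>The source is a subset \<open>A\<close> of a type, with an explicitly given distance \<open>dA\<close> on it.\<close>

definition qi_embedding_on ::
    "'a set \<Rightarrow> ('a \<Rightarrow> 'a \<Rightarrow> real) \<Rightarrow> ('a \<Rightarrow> 'x::metric_space) \<Rightarrow> bool" where
  "qi_embedding_on A dA f \<longleftrightarrow>
     (\<exists>L\<ge>1. \<exists>C\<ge>0. \<forall>a\<in>A. \<forall>b\<in>A.
        dA a b / L - C \<le> dist (f a) (f b) \<and> dist (f a) (f b) \<le> L * dA a b + C)"


section \<open>Isometric group actions\<close>

definition isometric_action ::
    "('g, 'm) monoid_scheme \<Rightarrow> ('g \<Rightarrow> 'x::metric_space \<Rightarrow> 'x) \<Rightarrow> bool" where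
  "isometric_action G \<phi> \<longleftrightarrow> group_action G UNIV \<phi> \<and>
     (\<forall>g\<in>carrier G. \<forall>x y. dist (\<phi> g x) (\<phi> g y) = dist x y)"

text \<open>Conditions below of the form \<open>\<exists>x. \<dots>\<close> on an orbit do not depend on the choice of the
  basepoint \<open>x\<close>.\<close>

definition loxodromic ::
    "('g, 'm) monoid_scheme \<Rightarrow> ('g \<Rightarrow> 'x::metric_space \<Rightarrow> 'x) \<Rightarrow> 'g \<Rightarrow> bool" where
  "loxodromic G \<phi> g \<longleftrightarrow> g \<in> carrier G \<and>
     (\<exists>x. qi_embedding_on (UNIV :: int set) dist (\<lambda>n. \<phi> (g [^]\<^bsub>G\<^esub> n) x))"

definition WPD ::
    "('g, 'm) monoid_scheme \<Rightarrow> ('g \<Rightarrow> 'x::metric_space \<Rightarrow> 'x) \<Rightarrow> 'g \<Rightarrow> bool" where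
  "WPD G \<phi> g \<longleftrightarrow>
     (\<forall>x. \<forall>\<epsilon>\<ge>0. \<exists>N::nat. N > 0 \<and>
        finite {\<gamma> \<in> carrier G. dist x (\<phi> \<gamma> x) \<le> \<epsilon> \<and>
          dist (\<phi> (g [^]\<^bsub>G\<^esub> N) x) (\<phi> \<gamma> (\<phi> (g [^]\<^bsub>G\<^esub> N) x)) \<le> \<epsilon>})"

definition loxodromic_WPD ::
    "('g, 'm) monoid_scheme \<Rightarrow> ('g \<Rightarrow> 'x::metric_space \<Rightarrow> 'x) \<Rightarrow> 'g \<Rightarrow> bool" where
  "loxodromic_WPD G \<phi> g \<longleftrightarrow> loxodromic G \<phi> g \<and> WPD G \<phi> g"

definition independent_family ::
    "('g \<Rightarrow> 'x::metric_space \<Rightarrow> 'x) \<Rightarrow> 'i set \<Rightarrow> ('i \<Rightarrow> 'g) \<Rightarrow> bool" where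
  "independent_family \<phi> I h \<longleftrightarrow>
     (\<forall>i\<in>I. \<forall>j\<in>I. i \<noteq> j \<longrightarrow>
        boundary_fixed_points (\<phi> (h i)) \<inter> boundary_fixed_points (\<phi> (h j)) = {})"

definition acylindrical_along_set ::
    "('g, 'm) monoid_scheme \<Rightarrow> ('g \<Rightarrow> 'x::metric_space \<Rightarrow> 'x) \<Rightarrow> 'x set \<Rightarrow> bool" where
  "acylindrical_along_set G \<phi> Y \<longleftrightarrow>
     (\<forall>\<epsilon>\<ge>0. \<exists>R>0. \<exists>M::nat. M > 0 \<and> (\<forall>x\<in>Y. \<forall>y\<in>Y. dist x y \<ge> R \<longrightarrow>
        finite {g \<in> carrier G. dist (\<phi> g x) x \<le> \<epsilon> \<and> dist (\<phi> g y) y \<le> \<epsilon>} \<and>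
        card {g \<in> carrier G. dist (\<phi> g x) x \<le> \<epsilon> \<and> dist (\<phi> g y) y \<le> \<epsilon>} \<le> M))"

definition acylindrical_along ::
    "('g, 'm) monoid_scheme \<Rightarrow> ('g \<Rightarrow> 'x::metric_space \<Rightarrow> 'x) \<Rightarrow> 'g set \<Rightarrow> bool" where
  "acylindrical_along G \<phi> H \<longleftrightarrow> (\<exists>x. acylindrical_along_set G \<phi> ((\<lambda>h. \<phi> h x) ` H))"

definition finite_generating_set ::
    "('g, 'm) monoid_scheme \<Rightarrow> 'g set \<Rightarrow> 'g set \<Rightarrow> bool" where
  "finite_generating_set G H S \<longleftrightarrow> finite S \<and> S \<subseteq> carrier G \<and> generate G S = H"

text \<open>The word length is only meaningful on the subgroup generated by \<open>S\<close>; elsewhere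
  the minimum ranges over the empty set.\<close>

definition word_length :: "('g, 'm) monoid_scheme \<Rightarrow> 'g set \<Rightarrow> 'g \<Rightarrow> nat" where
  "word_length G S a =
     (LEAST n. \<exists>ws. length ws = n \<and> set ws \<subseteq> S \<union> m_inv G ` S \<and>
        foldr (\<otimes>\<^bsub>G\<^esub>) ws \<one>\<^bsub>G\<^esub> = a)"

definition word_dist :: "('g, 'm) monoid_scheme \<Rightarrow> 'g set \<Rightarrow> 'g \<Rightarrow> 'g \<Rightarrow> real" where
  "word_dist G S a b = real (word_length G S (inv\<^bsub>G\<^esub> a \<otimes>\<^bsub>G\<^esub> b))"

text \<open>The word metrics of two finite generating sets are bi-Lipschitz equivalent, so the choice
  of \<open>S\<close> is immaterial.\<close>

definition qi_embedded_by_action ::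
    "('g, 'm) monoid_scheme \<Rightarrow> ('g \<Rightarrow> 'x::metric_space \<Rightarrow> 'x) \<Rightarrow> 'g set \<Rightarrow> bool" where
  "qi_embedded_by_action G \<phi> H \<longleftrightarrow>
     (\<exists>S x. finite_generating_set G H S \<and> qi_embedding_on H (word_dist G S) (\<lambda>h. \<phi> h x))"

text \<open>The space of the triple is the type \<open>'x\<close> on which \<open>\<phi>\<close> acts.\<close>

definition AQI_triple ::
    "('g, 'm) monoid_scheme \<Rightarrow> ('g \<Rightarrow> 'x::metric_space \<Rightarrow> 'x) \<Rightarrow> 'g set \<Rightarrow> bool" where
  "AQI_triple G \<phi> H \<longleftrightarrow>
     hyperbolic_space TYPE('x) \<and> isometric_action G \<phi> \<and>
     subgroup H G \<and> (\<exists>S. finite_generating_set G H S) \<and> infinite H \<and>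
     acylindrical_along G \<phi> H \<and> qi_embedded_by_action G \<phi> H"

end

theory Submission
  imports Defs
begin

text \<open>Only the four-point inequality is used. In a \<open>\<delta>\<close>-hyperbolic space a broken path with long
  steps and uniformly bounded Gromov products at its vertices makes linear progress and stays close
  to the segment between its ends. Applied to the powers of a loxodromic element this shows that
  its orbits are coarse rays; by independence the rays of the \<open>h i\<close> and of their inverses pairwise
  have bounded Gromov products. So reduced words in high powers of the \<open>h i\<close> trace broken paths, which
  gives the quasi-isometric embedding and, for cyclically reduced words, loxodromicity.

  For acylindricity, suppose that infinitely many isometries move both ends of a long word path by
  at most \<open>\<epsilon>\<close>. Each of them moves the middle of the path almost along the path. By the pigeonhole
  principle the quotients of infinitely many of them move some middle letter by an amount that
  depends only on \<open>\<delta>\<close> and the bound on the Gromov products, not on \<open>\<epsilon>\<close>, and the WPD property of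
  \<open>h i\<close> excludes this once the powers are high enough. Uniformity is automatic, as there are only
  finitely many words of each length. WPD of the elements of \<open>H\<close> follows from acylindricity.\<close>

section \<open>Gromov products and consequences of the four-point inequality\<close>

lemma gromov_product_commute: "gromov_product w x y = gromov_product w y x"
  by (simp add: gromov_product_def dist_commute)

lemma gromov_product_nonneg: "0 \<le> gromov_product w x y"
  using dist_triangle[of x y w] by (simp add: gromov_product_def dist_commute)

lemma gromov_product_self [simp]: "gromov_product w w y = 0"
  by (simp add: gromov_product_def dist_commute)

text \<open>The products at the two ends of a side of a triangle add up to its length, so a small
  product at one end of a long segment is a large one at the other.\<close>

lemma gromov_product_swap: "gromov_product w x y = dist w x - gromov_product x w y"
  by (simp add: gromov_product_def dist_commute field_simps)

lemma gromov_product_perturb: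
  "gromov_product w x y \<le> gromov_product w' x y' + dist w w' + dist y y'"
proof -
  have "dist x w \<le> dist x w' + dist w w'"
    using dist_triangle[of x w w'] by (simp add: dist_commute)
  moreover have "dist y w \<le> dist y' w' + dist w w' + dist y y'"
    using dist_triangle[of y w y'] dist_triangle[of y' w w'] by (simp add: dist_commute)
  moreover have "dist x y' \<le> dist x y + dist y y'"
    by (rule dist_triangle)
  ultimately show ?thesis
    by (simp add: gromov_product_def field_simps)
qed

lemma gromov_product_base_le: "gromov_product w x y \<le> gromov_product w' x y + dist w w'"
  using gromov_product_perturb[of w x y w' y] by simp

locale delta_hyperbolic =
  fixes X :: "'x::metric_space itself" and \<delta> :: real
  assumes delta_nonneg: "0 \<le> \<delta>"
    and four_point: "\<And>w x y z :: 'x.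
      min (gromov_product w x y) (gromov_product w y z) - \<delta> \<le> gromov_product w x z"
begin

lemma four_point_chain:
  fixes w x y z v :: 'x
  shows "min (gromov_product w x y) (min (gromov_product w y z) (gromov_product w z v)) - 2 * \<delta>
    \<le> gromov_product w x v"
  using four_point[of w x y v] four_point[of w y z v] delta_nonneg by (simp add: min_def split: if_splits)

text \<open>Clearing the base point turns the four-point inequality into a comparison of the three
  ways of pairing four points.\<close>

lemma four_point_dist:
  fixes p q y z :: 'x
  shows "dist y z + dist p q \<le> max (dist p y + dist q z) (dist p z + dist q y) + 2 * \<delta>"
  using four_point[of p y q z]
  by (simp add: gromov_product_def dist_commute min_def max_def field_simps split: if_splits)

text \<open>Both sums in the maximum of \<open>four_point_dist\<close> are at most
  \<open>dist p y + dist q y + e\<close>, and the bound on the product makes this at most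
  \<open>dist p q + 2 * b + e\<close>.\<close>

lemma displacement_between:
  fixes p q y z :: 'x
  assumes "gromov_product y p q \<le> b" "dist p z \<le> dist p y + e" "dist q z \<le> dist q y + e"
  shows "dist z y \<le> e + 2 * b + 2 * \<delta>"
  using four_point_dist[of y z p q] assms
  by (simp add: gromov_product_def dist_commute max_def field_simps split: if_splits)

text \<open>Exchanging \<open>dist p y\<close> and \<open>dist p z\<close> costs \<open>e\<close>
  and turns each sum in \<open>four_point_dist\<close> into \<open>dist p q\<close> plus twice a
  product.\<close>

lemma dist_same_shadow:
  fixes p q y z :: 'x
  assumes "gromov_product y p q \<le> b" "gromov_product z p q \<le> b" "\<bar>dist p y - dist p z\<bar> \<le> e"
  shows "dist y z \<le> 2 * b + 2 * \<delta> + e"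
  using four_point_dist[of y z p q] assms
  by (simp add: gromov_product_def dist_commute max_def field_simps abs_if split: if_splits)

text \<open>From the distant point \<open>y\<close> an end and its displaced copy lie in nearly the
  same direction, so in the chain \<open>p'\<close>, \<open>p\<close>, \<open>q\<close>,
  \<open>q'\<close> only the product of \<open>p\<close> and \<open>q\<close> can be small. The
  displacement \<open>e\<close> decides how far away \<open>y\<close> must be but does not enter the
  bound.\<close>

lemma gromov_product_move_ends:
  fixes p q p' q' y :: 'x
  assumes "gromov_product y p' q' \<le> b" "dist p p' \<le> e" "dist q q' \<le> e"
    and "e + b + 2 * \<delta> < dist p' y" "e + b + 2 * \<delta> < dist q' y"
  shows "gromov_product y p q \<le> b + 2 * \<delta>"
proof -
  have "dist p' y \<le> dist p y + e" "dist q' y \<le> dist q y + e"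
    using dist_triangle[of p' y p] dist_triangle[of q' y q] assms by (auto simp: dist_commute)
  then have "b + 2 * \<delta> < gromov_product y p' p" "b + 2 * \<delta> < gromov_product y q q'"
    using assms by (auto simp: gromov_product_def dist_commute field_simps)
  then show ?thesis
    using four_point_chain[of y p' p q q'] assms(1) by (simp add: min_def split: if_splits)
qed

section \<open>Broken paths\<close>

text \<open>The step length is tailored to the inductions below: a product of at most
  \<open>B + \<delta>\<close> at one end of a step leaves at least
  \<open>B + 2 * \<delta> + 1\<close> at the other, and a step minus
  \<open>2 * (B + \<delta>)\<close> is still at least \<open>\<delta> + 1\<close>.\<close>

definition broken_path :: "real \<Rightarrow> (nat \<Rightarrow> 'x) \<Rightarrow> nat \<Rightarrow> bool" where
  "broken_path B f n \<longleftrightarrow> 0 \<le> B \<and>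
     (\<forall>i<n. 2 * B + 3 * \<delta> + 1 \<le> dist (f i) (f (Suc i))) \<and>
     (\<forall>i. Suc i < n \<longrightarrow> gromov_product (f (Suc i)) (f i) (f (Suc (Suc i))) \<le> B)"

lemma broken_path_shift:
  "broken_path B f n \<Longrightarrow> j \<le> n \<Longrightarrow> broken_path B (\<lambda>k. f (i + k)) (j - i)"
  by (auto simp: broken_path_def)

lemma broken_path_rev:
  assumes "broken_path B f n"
  shows "broken_path B (\<lambda>k. f (n - k)) n"
  unfolding broken_path_def
proof (intro conjI allI impI)
  show "0 \<le> B" using assms by (simp add: broken_path_def)
  fix i
  show "2 * B + 3 * \<delta> + 1 \<le> dist (f (n - i)) (f (n - Suc i))" if "i < n"
  proof -
    define j where "j = n - Suc i"
    have "n - i = Suc j" "j < n" using that by (auto simp: j_def)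
    then show ?thesis using assms by (simp add: broken_path_def dist_commute flip: j_def)
  qed
  show "gromov_product (f (n - Suc i)) (f (n - i)) (f (n - Suc (Suc i))) \<le> B" if "Suc i < n"
  proof -
    define j where "j = n - Suc (Suc i)"
    have "n - Suc i = Suc j" "n - i = Suc (Suc j)" "Suc j < n" using that by (auto simp: j_def)
    then show ?thesis using assms
      by (simp add: broken_path_def gromov_product_commute flip: j_def)
  qed
qed

text \<open>Since \<open>f j\<close> is far from \<open>f (j + 1)\<close> and seen from \<open>f j\<close> the point \<open>f 0\<close> lies in almost the
  opposite direction, \<open>f 0\<close> and \<open>f j\<close> have a large product at \<open>f (j + 1)\<close>; so the local bound there
  passes from \<open>f j\<close> to \<open>f 0\<close>.\<close>

lemma broken_path_product_next:
  assumes "broken_path B f n" "j < n"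
  shows "gromov_product (f j) (f 0) (f (Suc j)) \<le> B + \<delta>"
  using assms(2)
proof (induction j)
  case 0
  then show ?case using assms delta_nonneg by (simp add: broken_path_def)
next
  case (Suc j)
  have "gromov_product (f (Suc j)) (f 0) (f j) = dist (f (Suc j)) (f j) - gromov_product (f j) (f 0) (f (Suc j))"
    using gromov_product_swap[of "f (Suc j)" "f j" "f 0"] by (simp add: gromov_product_commute)
  moreover have "dist (f (Suc j)) (f j) \<ge> 2 * B + 3 * \<delta> + 1"
    using assms Suc.prems by (simp add: broken_path_def dist_commute)
  ultimately have "gromov_product (f (Suc j)) (f j) (f 0) > B + \<delta>"
    using Suc assms delta_nonneg by (simp add: broken_path_def gromov_product_commute)
  moreover have "gromov_product (f (Suc j)) (f j) (f (Suc (Suc j))) \<le> B"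
    using assms Suc.prems by (simp add: broken_path_def)
  ultimately show ?case
    using four_point[of "f (Suc j)" "f j" "f 0" "f (Suc (Suc j))"]
    by (simp add: min_def split: if_splits)
qed

text \<open>By \<open>broken_path_product_next\<close> each step takes the path farther from
  \<open>f 0\<close> by at least the step length minus \<open>2 * (B + \<delta>)\<close>.\<close>

lemma broken_path_length:
  assumes "broken_path B f n"
  shows "real n \<le> dist (f 0) (f n)"
proof -
  have "real j \<le> dist (f 0) (f j)" if "j \<le> n" for j
    using that
  proof (induction j)
    case (Suc j)
    have "gromov_product (f j) (f 0) (f (Suc j)) \<le> B + \<delta>"
      using broken_path_product_next[OF assms] Suc.prems by simp
    moreover have "dist (f j) (f (Suc j)) \<ge> 2 * B + 3 * \<delta> + 1"
      using assms Suc.prems by (simp add: broken_path_def)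
    ultimately show ?case
      using Suc delta_nonneg by (simp add: gromov_product_def dist_commute field_simps)
  qed simp
  then show ?thesis by blast
qed

lemma broken_path_dist:
  assumes "broken_path B f n" "i \<le> j" "j \<le> n"
  shows "real (j - i) \<le> dist (f i) (f j)"
  using broken_path_length[OF broken_path_shift[OF assms(1,3), of i]] assms(2) by simp

text \<open>On the reversed path \<open>broken_path_product_next\<close> shows that from
  \<open>f j\<close> the points \<open>f n\<close> and \<open>f (Suc j)\<close> lie in nearly the
  same direction; so the bound for \<open>f (Suc j)\<close> passes to \<open>f n\<close> at the cost
  of another \<open>\<delta>\<close>.\<close>

lemma broken_path_product:
  assumes "broken_path B f n" "j \<le> n"
  shows "gromov_product (f j) (f 0) (f n) \<le> B + 2 * \<delta>"
proof (cases "j = n")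
  case True
  then show ?thesis
    using assms delta_nonneg gromov_product_commute[of "f n" "f 0" "f n"]
    by (simp add: broken_path_def)
next
  case False
  with assms have j: "j < n" by simp
  have "gromov_product (f (n - (n - Suc j))) (f (n - 0)) (f (n - Suc (n - Suc j))) \<le> B + \<delta>"
    by (rule broken_path_product_next[OF broken_path_rev[OF assms(1)]]) (use j in simp)
  moreover have "n - (n - Suc j) = Suc j" "n - Suc (n - Suc j) = j" using j by auto
  ultimately have "gromov_product (f (Suc j)) (f n) (f j) \<le> B + \<delta>" by simp
  moreover have "dist (f j) (f (Suc j)) \<ge> 2 * B + 3 * \<delta> + 1"
    using assms j by (simp add: broken_path_def)
  ultimately have "gromov_product (f j) (f n) (f (Suc j)) > B + 2 * \<delta>"
    using gromov_product_swap[of "f j" "f (Suc j)" "f n"] assms(1) delta_nonneg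
    by (simp add: broken_path_def gromov_product_commute)
  moreover have "gromov_product (f j) (f 0) (f (Suc j)) \<le> B + \<delta>"
    using broken_path_product_next[OF assms(1) j] .
  ultimately show ?thesis
    using four_point[of "f j" "f 0" "f n" "f (Suc j)"]
    by (simp add: min_def split: if_splits)
qed

end

section \<open>Points at infinity\<close>

lemma converges_to_infinityI:
  fixes u :: "nat \<Rightarrow> 'x::metric_space"
  assumes "\<And>Z. \<exists>N. \<forall>m\<ge>N. \<forall>n\<ge>N. Z \<le> gromov_product w (u m) (u n)"
  shows "converges_to_infinity u"
  unfolding converges_to_infinity_def filterlim_at_top eventually_prod_sequentially
proof (intro allI)
  fix w' Z
  obtain N where N: "\<forall>m\<ge>N. \<forall>n\<ge>N. Z + dist w w' \<le> gromov_product w (u m) (u n)"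
    using assms by blast
  have "Z \<le> gromov_product w' (u n) (u m)" if "m \<ge> N" "n \<ge> N" for m n
    using N[rule_format, OF that(2,1)] gromov_product_base_le[of w "u n" "u m" w'] by linarith
  then show "\<exists>N. \<forall>m\<ge>N. \<forall>n\<ge>N. Z \<le> (case (n, m) of (m, n) \<Rightarrow> gromov_product w' (u m) (u n))"
    by auto
qed

lemma converges_to_infinityD:
  assumes "converges_to_infinity u"
  shows "\<exists>N. \<forall>m\<ge>N. \<forall>n\<ge>N. Z \<le> gromov_product w (u m) (u n)"
proof -
  have "\<exists>N. \<forall>m\<ge>N. \<forall>n\<ge>N. Z \<le> gromov_product w (u n) (u m)"
    using assms[unfolded converges_to_infinity_def filterlim_at_top eventually_prod_sequentially]
    by simp
  then show ?thesis by blast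
qed

lemma boundary_relI:
  assumes "converges_to_infinity u" "converges_to_infinity v"
    and "filterlim (\<lambda>n. gromov_product w (u n) (v n)) at_top sequentially"
  shows "(u, v) \<in> boundary_rel"
proof -
  have "filterlim (\<lambda>n. gromov_product w' (u n) (v n)) at_top sequentially" for w'
    unfolding filterlim_at_top
  proof
    fix Z
    have "\<forall>\<^sub>F n in sequentially. Z + dist w w' \<le> gromov_product w (u n) (v n)"
      using assms(3) by (simp add: filterlim_at_top)
    then show "\<forall>\<^sub>F n in sequentially. Z \<le> gromov_product w' (u n) (v n)"
      by eventually_elim (use gromov_product_base_le[of w _ _ w'] in \<open>smt (verit, best)\<close>)
  qed
  with assms show ?thesis by (simp add: boundary_rel_def)
qed

lemma boundary_rel_sym: "(u, v) \<in> boundary_rel \<Longrightarrow> (v, u) \<in> boundary_rel"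
  by (simp add: boundary_rel_def gromov_product_commute)

lemma boundary_rel_refl:
  assumes "converges_to_infinity u"
  shows "(u, u) \<in> boundary_rel"
proof (rule boundary_relI[OF assms assms])
  show "filterlim (\<lambda>n. gromov_product undefined (u n) (u n)) at_top sequentially"
    unfolding filterlim_at_top eventually_sequentially
    using converges_to_infinityD[OF assms, of _ undefined] by blast
qed

context delta_hyperbolic
begin

lemma boundary_rel_trans:
  fixes u v z :: "nat \<Rightarrow> 'x"
  assumes "(u, v) \<in> boundary_rel" "(v, z) \<in> boundary_rel"
  shows "(u, z) \<in> boundary_rel"
proof (rule boundary_relI)
  show "converges_to_infinity u" "converges_to_infinity z"
    using assms by (auto simp: boundary_rel_def)
  fix w
  show "filterlim (\<lambda>n. gromov_product w (u n) (z n)) at_top sequentially"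
    unfolding filterlim_at_top
  proof
    fix Z
    have "\<forall>\<^sub>F n in sequentially. Z + \<delta> \<le> gromov_product w (u n) (v n)"
      "\<forall>\<^sub>F n in sequentially. Z + \<delta> \<le> gromov_product w (v n) (z n)"
      using assms by (auto simp: boundary_rel_def filterlim_at_top)
    then show "\<forall>\<^sub>F n in sequentially. Z \<le> gromov_product w (u n) (z n)"
    proof eventually_elim
      case (elim n)
      then show ?case using four_point[of w "u n" "v n" "z n"] by linarith
    qed
  qed
qed

lemma boundary_class_eq:
  fixes u v :: "nat \<Rightarrow> 'x"
  assumes "(u, v) \<in> boundary_rel"
  shows "boundary_rel `` {u} = boundary_rel `` {v}"
  using assms boundary_rel_trans boundary_rel_sym by blast

lemma boundary_rel_isometry:
  fixes u v :: "nat \<Rightarrow> 'x"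
  assumes "(u, v) \<in> boundary_rel" and iso: "\<And>x y. dist (f x) (f y) = dist x y"
  shows "(f \<circ> u, f \<circ> v) \<in> boundary_rel"
proof -
  have gp: "gromov_product (f w) (f x) (f y) = gromov_product w x y" for w x y
    by (simp add: gromov_product_def iso)
  \<comment> \<open>One base point suffices; taking it in the image of \<open>f\<close> lets
    \<open>gp\<close> remove \<open>f\<close> from the whole product.\<close>
  have conv: "converges_to_infinity (f \<circ> t)" if "converges_to_infinity t" for t
    by (rule converges_to_infinityI[where w = "f undefined"])
      (use converges_to_infinityD[OF that] in \<open>simp add: gp\<close>)
  show ?thesis
    by (rule boundary_relI[where w = "f undefined"])
      (use assms(1) conv in \<open>auto simp: boundary_rel_def gp\<close>)
qed

text \<open>A boundary point is a class of sequences, so fixing it means equality of sets. The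
  assumed relation gives one inclusion, and its image under the inverse \<open>f'\<close> gives the
  other.\<close>

lemma boundary_fixed_pointI:
  fixes u :: "nat \<Rightarrow> 'x"
  assumes "(f \<circ> u, u) \<in> boundary_rel" and iso: "\<And>x y. dist (f x) (f y) = dist x y"
    and "\<And>x. f (f' x) = x" "\<And>x. f' (f x) = x"
  shows "boundary_rel `` {u} \<in> boundary_fixed_points f"
proof -
  have iso': "dist (f' x) (f' y) = dist x y" for x y
    by (metis assms(3) iso)
  have inv: "f' \<circ> (f \<circ> v) = v" "f \<circ> (f' \<circ> v) = v" for v :: "nat \<Rightarrow> 'x"
    using assms by auto
  have "f \<circ> v \<in> boundary_rel `` {u}" if "v \<in> boundary_rel `` {u}" for v
    using boundary_rel_trans[OF boundary_rel_sym[OF assms(1)] boundary_rel_isometry[OF _ iso]] that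
    by blast
  moreover have "(f' \<circ> u, u) \<in> boundary_rel"
    using boundary_rel_isometry[OF boundary_rel_sym[OF assms(1)] iso'] inv by simp
  then have "f' \<circ> v \<in> boundary_rel `` {u}" if "v \<in> boundary_rel `` {u}" for v
    using boundary_rel_trans[OF boundary_rel_sym boundary_rel_isometry[OF _ iso']] that
    by blast
  ultimately have "(\<lambda>v. f \<circ> v) ` (boundary_rel `` {u}) = boundary_rel `` {u}"
    using inv by (smt (verit, best) image_iff set_eq_subset subsetI)
  moreover have "boundary_rel `` {u} \<in> gromov_boundary"
    using assms(1) by (auto simp: gromov_boundary_def quotient_def boundary_rel_def)
  ultimately show ?thesis by (simp add: boundary_fixed_points_def)
qed

text \<open>A substitute for quasi-geodesic rays without control of the parametrization: only
  products with the start \<open>u 0\<close> enter, which is enough to compare two rays from a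
  common start.\<close>

definition coarse_ray :: "real \<Rightarrow> (nat \<Rightarrow> 'x) \<Rightarrow> bool" where
  "coarse_ray B u \<longleftrightarrow> (\<forall>m n. m \<le> n \<longrightarrow> gromov_product (u m) (u 0) (u n) \<le> B) \<and>
     filterlim (\<lambda>n. dist (u 0) (u n)) at_top sequentially"

lemma coarse_ray_product:
  assumes "coarse_ray B u" "m \<le> n"
  shows "dist (u 0) (u m) - B \<le> gromov_product (u 0) (u m) (u n)"
  using assms gromov_product_swap[of "u 0" "u m" "u n"] by (auto simp: coarse_ray_def)

lemma coarse_ray_converges:
  assumes "coarse_ray B u"
  shows "converges_to_infinity u"
proof (rule converges_to_infinityI[where w = "u 0"])
  fix Z
  obtain N where N: "\<And>n. n \<ge> N \<Longrightarrow> Z + B \<le> dist (u 0) (u n)"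
    using assms unfolding coarse_ray_def filterlim_at_top eventually_sequentially by meson
  have "Z \<le> gromov_product (u 0) (u m) (u n)" if "m \<ge> N" "n \<ge> N" for m n
    using coarse_ray_product[OF assms, of m n] coarse_ray_product[OF assms, of n m]
      N[OF that(1)] N[OF that(2)] gromov_product_commute[of "u 0" "u m" "u n"]
    by (cases "m \<le> n") auto
  then show "\<exists>N. \<forall>m\<ge>N. \<forall>n\<ge>N. Z \<le> gromov_product (u 0) (u m) (u n)" by blast
qed

text \<open>A large product of \<open>u m\<close> and \<open>v n\<close> forces both points to be
  far out, and later points of each ray lie in nearly the same direction. So one large product
  bounds all later ones from below.\<close>

lemma coarse_rays_asymptotic:
  assumes u: "coarse_ray B u" and v: "coarse_ray B v" and "u 0 = v 0"
    and unbounded: "\<And>K. \<exists>m n. K \<le> gromov_product (u 0) (u m) (v n)"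
  shows "(u, v) \<in> boundary_rel"
proof (rule boundary_relI[where w = "u 0"])
  show "converges_to_infinity u" "converges_to_infinity v"
    using u v coarse_ray_converges by auto
  show "filterlim (\<lambda>n. gromov_product (u 0) (u n) (v n)) at_top sequentially"
    unfolding filterlim_at_top eventually_sequentially
  proof
    fix Z
    \<comment> \<open>The term \<open>\<bar>B\<bar>\<close> absorbs the loss \<open>B\<close> along
      each ray and, being nonnegative whatever the sign of \<open>B\<close>, leaves
      \<open>Z + 2 * \<delta>\<close> for the middle product as well.\<close>
    obtain m n where mn: "Z + \<bar>B\<bar> + 2 * \<delta> \<le> gromov_product (u 0) (u m) (v n)"
      using unbounded by blast
    have le: "gromov_product (u 0) (u m) (v n) \<le> dist (u 0) (u m)"
      "gromov_product (u 0) (u m) (v n) \<le> dist (u 0) (v n)"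
      using gromov_product_swap[of "u 0" "u m" "v n"] gromov_product_swap[of "u 0" "v n" "u m"]
        gromov_product_nonneg[of "u m" "u 0" "v n"] gromov_product_nonneg[of "v n" "u 0" "u m"]
      by (simp_all add: gromov_product_commute)
    have "Z \<le> gromov_product (u 0) (u i) (v i)" if "i \<ge> max m n" for i
    proof -
      have "Z + 2 * \<delta> \<le> gromov_product (u 0) (u i) (u m)"
        using coarse_ray_product[OF u, of m i] that mn le gromov_product_commute[of "u 0" "u i" "u m"] by simp
      moreover have "Z + 2 * \<delta> \<le> gromov_product (u 0) (v n) (v i)"
        using coarse_ray_product[OF v, of n i] that mn le \<open>u 0 = v 0\<close> by simp
      ultimately show ?thesis
        using four_point_chain[of "u 0" "u i" "u m" "v n" "v i"] mn by simp
    qed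
    then show "\<exists>N. \<forall>i\<ge>N. Z \<le> gromov_product (u 0) (u i) (v i)" by blast
  qed
qed

end

section \<open>Isometric actions and coarse stabilizers\<close>

locale hyperbolic_action = delta_hyperbolic X \<delta> + group G
  for X :: "'x::metric_space itself" and \<delta> and G (structure) +
  fixes \<phi> :: "'g \<Rightarrow> 'x \<Rightarrow> 'x"
  assumes action: "isometric_action G \<phi>"
begin

lemma act_one [simp]: "\<phi> \<one> x = x"
  using group_action.id_eq_one[of G UNIV \<phi>] action
  by (metis UNIV_I isometric_action_def restrict_apply')

lemma act_mult: "g \<in> carrier G \<Longrightarrow> h \<in> carrier G \<Longrightarrow> \<phi> (g \<otimes> h) x = \<phi> g (\<phi> h x)"
  using group_action.composition_rule[of G UNIV \<phi>] action by (simp add: isometric_action_def)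

lemma act_dist [simp]: "g \<in> carrier G \<Longrightarrow> dist (\<phi> g x) (\<phi> g y) = dist x y"
  using action by (simp add: isometric_action_def)

lemma act_gromov_product [simp]:
  "g \<in> carrier G \<Longrightarrow> gromov_product (\<phi> g w) (\<phi> g x) (\<phi> g y) = gromov_product w x y"
  by (simp add: gromov_product_def)

lemma act_inv [simp]:
  assumes "g \<in> carrier G"
  shows "\<phi> (inv g) (\<phi> g x) = x" "\<phi> g (\<phi> (inv g) x) = x"
  using assms by (simp_all flip: act_mult)

lemma dist_act_left:
  assumes "g \<in> carrier G"
  shows "dist (\<phi> g x) y = dist x (\<phi> (inv g) y)"
  using act_dist[OF assms, of x "\<phi> (inv g) y"] assms by simp

text \<open>Acylindricity and WPD are both finiteness statements about these sets; for WPD,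
  \<open>q\<close> is the image of \<open>p\<close> under a power.\<close>

definition coarse_stab :: "real \<Rightarrow> 'x \<Rightarrow> 'x \<Rightarrow> 'g set" where
  "coarse_stab c p q = {\<gamma> \<in> carrier G. dist (\<phi> \<gamma> p) p \<le> c \<and> dist (\<phi> \<gamma> q) q \<le> c}"

lemma coarse_stab_commute: "coarse_stab c p q = coarse_stab c q p"
  by (auto simp: coarse_stab_def)

lemma coarse_stab_conj:
  assumes "g \<in> carrier G" "\<gamma> \<in> coarse_stab c (\<phi> g p) (\<phi> g q)"
  shows "inv g \<otimes> \<gamma> \<otimes> g \<in> coarse_stab c p q"
  using assms
  by (simp add: coarse_stab_def act_mult dist_act_left[of "inv g"])

lemma inj_on_conj: "g \<in> carrier G \<Longrightarrow> inj_on (\<lambda>\<gamma>. inv g \<otimes> \<gamma> \<otimes> g) (carrier G)"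
  by (intro inj_onI) simp

text \<open>Conjugation by \<open>g\<close> embeds one coarse stabilizer in the other, so pairs of
  orbit points reduce to pairs that start at the base point.\<close>

lemma coarse_stab_translate:
  assumes "g \<in> carrier G" "finite (coarse_stab c p q)"
  shows "finite (coarse_stab c (\<phi> g p) (\<phi> g q))"
    "card (coarse_stab c (\<phi> g p) (\<phi> g q)) \<le> card (coarse_stab c p q)"
proof -
  have inj: "inj_on (\<lambda>\<gamma>. inv g \<otimes> \<gamma> \<otimes> g) (coarse_stab c (\<phi> g p) (\<phi> g q))"
    by (rule inj_on_subset[OF inj_on_conj]) (use assms in \<open>auto simp: coarse_stab_def\<close>)
  have im: "(\<lambda>\<gamma>. inv g \<otimes> \<gamma> \<otimes> g) ` coarse_stab c (\<phi> g p) (\<phi> g q) \<subseteq> coarse_stab c p q"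
    using coarse_stab_conj assms(1) by blast
  show "finite (coarse_stab c (\<phi> g p) (\<phi> g q))"
    using inj im assms(2) by (rule inj_on_finite)
  show "card (coarse_stab c (\<phi> g p) (\<phi> g q)) \<le> card (coarse_stab c p q)"
    using inj im assms(2) by (rule card_inj_on_le)
qed

text \<open>An element that moves \<open>p\<close> and \<open>q\<close> by at most \<open>c\<close>
  changes the distances from them to \<open>y\<close> by at most \<open>c\<close>, so
  \<open>displacement_between\<close> applies. This reduces long segments to initial pieces.\<close>

lemma coarse_stab_between:
  assumes "gromov_product y p q \<le> b"
  shows "coarse_stab c p q \<subseteq> coarse_stab (c + 2 * b + 2 * \<delta>) p y"
proof
  fix \<gamma> assume \<gamma>: "\<gamma> \<in> coarse_stab c p q"
  then have carr: "\<gamma> \<in> carrier G" by (simp add: coarse_stab_def)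
  have "dist p (\<phi> \<gamma> y) \<le> dist p y + c" "dist q (\<phi> \<gamma> y) \<le> dist q y + c"
    using \<gamma> dist_triangle[of p "\<phi> \<gamma> y" "\<phi> \<gamma> p"] dist_triangle[of q "\<phi> \<gamma> y" "\<phi> \<gamma> q"]
    by (auto simp: coarse_stab_def dist_commute)
  from displacement_between[OF assms this]
  have "dist (\<phi> \<gamma> y) y \<le> c + 2 * b + 2 * \<delta>" .
  moreover have "0 \<le> b"
    using assms gromov_product_nonneg[of y p q] by linarith
  ultimately show "\<gamma> \<in> coarse_stab (c + 2 * b + 2 * \<delta>) p y"
    using \<gamma> delta_nonneg by (simp add: coarse_stab_def)
qed

section \<open>Loxodromic elements\<close>

lemma dist_pow_le:
  assumes "g \<in> carrier G"
  shows "dist x (\<phi> (g [^] (n::nat)) x) \<le> real n * dist x (\<phi> g x)"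
proof (induction n)
  case (Suc n)
  have "dist x (\<phi> (g [^] Suc n) x) \<le> dist x (\<phi> (g [^] n) x) + dist (\<phi> (g [^] n) x) (\<phi> (g [^] n) (\<phi> g x))"
    using assms dist_triangle by (simp add: act_mult del: act_dist)
  with Suc show ?case using assms by (simp add: field_simps)
qed simp

lemma dist_pow_pow:
  fixes m n :: nat
  assumes "g \<in> carrier G" "m \<le> n"
  shows "dist (\<phi> (g [^] m) x) (\<phi> (g [^] n) x) = dist x (\<phi> (g [^] (n - m)) x)"
proof -
  have "g [^] n = g [^] m \<otimes> g [^] (n - m)"
    using assms by (simp add: nat_pow_mult)
  then show ?thesis using assms by (simp add: act_mult)
qed

lemma dist_int_pow:
  assumes "g \<in> carrier G"
  shows "dist (\<phi> (g [^] (a::int)) x) (\<phi> (g [^] (b::int)) x) = dist x (\<phi> (g [^] nat \<bar>b - a\<bar>) x)"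
proof -
  have *: "dist (\<phi> (g [^] a) x) (\<phi> (g [^] b) x) = dist x (\<phi> (g [^] nat (b - a)) x)" if "a \<le> b" for a b :: int
  proof -
    have "g [^] b = g [^] a \<otimes> g [^] (b - a)"
      using assms by (simp flip: int_pow_mult)
    moreover have "g [^] (b - a) = g [^] nat (b - a)"
      using that by (simp add: pow_nat)
    ultimately show ?thesis using assms by (simp add: act_mult)
  qed
  show ?thesis
    using *[of a b] *[of b a] by (cases "a \<le> b") (auto simp: dist_commute)
qed

text \<open>The upper bound holds for every element by the triangle inequality, and isometry reduces
  two integer exponents to their difference.\<close>

lemma loxodromicI:
  assumes "g \<in> carrier G" "\<And>n::nat. real n \<le> dist x (\<phi> (g [^] n) x)"
  shows "loxodromic G \<phi> g"
proof -
  define L where "L = max 1 (dist x (\<phi> g x))"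
  have "dist (real_of_int a) (real_of_int b) / L - 0 \<le> dist (\<phi> (g [^] a) x) (\<phi> (g [^] b) x) \<and>
        dist (\<phi> (g [^] a) x) (\<phi> (g [^] b) x) \<le> L * dist (real_of_int a) (real_of_int b) + 0" for a b :: int
  proof -
    have n: "dist (real_of_int a) (real_of_int b) = real (nat \<bar>b - a\<bar>)"
      by (simp add: dist_real_def abs_minus_commute)
    have "L \<ge> 1" "dist x (\<phi> g x) \<le> L" by (simp_all add: L_def)
    then have "real m / L \<le> real m" "real m * dist x (\<phi> g x) \<le> L * real m" for m
      using mult_left_mono[of 1 L "real m"] mult_left_mono[of "dist x (\<phi> g x)" L "real m"]
      by (simp_all add: divide_le_eq mult.commute)
    then show ?thesis
      unfolding n dist_int_pow[OF assms(1)]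
      using assms(2)[of "nat \<bar>b - a\<bar>"] dist_pow_le[OF assms(1), of x "nat \<bar>b - a\<bar>"]
      by (smt (verit))
  qed
  moreover have "L \<ge> 1" by (simp add: L_def)
  ultimately show ?thesis
    unfolding loxodromic_def qi_embedding_on_def using assms(1) by blast
qed

text \<open>Moves the lower bound from the base point hidden in the definition to a given
  \<open>x\<close>, at the cost of \<open>2 * dist x y\<close> in the constant.\<close>

lemma loxodromicE:
  assumes "loxodromic G \<phi> g"
  obtains L C where "L \<ge> 1" "C \<ge> 0" "\<And>n::nat. real n / L - C \<le> dist x (\<phi> (g [^] n) x)"
proof -
  have g: "g \<in> carrier G" using assms by (simp add: loxodromic_def)
  obtain y L C where y: "L \<ge> 1" "C \<ge> 0"
    "\<And>a b::int. dist (real_of_int a) (real_of_int b) / L - C \<le> dist (\<phi> (g [^] a) y) (\<phi> (g [^] b) y)"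
    using assms unfolding loxodromic_def qi_embedding_on_def by blast
  have "real n / L - (C + 2 * dist x y) \<le> dist x (\<phi> (g [^] n) x)" for n :: nat
  proof -
    have "real n / L - C \<le> dist y (\<phi> (g [^] n) y)"
      using y(3)[of 0 "int n"] by (simp add: int_pow_int dist_real_def)
    moreover have "dist y (\<phi> (g [^] n) y) \<le> dist y x + dist x (\<phi> (g [^] n) x) + dist (\<phi> (g [^] n) x) (\<phi> (g [^] n) y)"
      using dist_triangle[of y "\<phi> (g [^] n) y" x] dist_triangle[of x "\<phi> (g [^] n) y" "\<phi> (g [^] n) x"] by linarith
    ultimately show ?thesis using g by (simp add: dist_commute)
  qed
  with y that[of L "C + 2 * dist x y"] show ?thesis by simp
qed

lemma loxodromic_inv:
  assumes "loxodromic G \<phi> g"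
  shows "loxodromic G \<phi> (inv g)"
proof -
  have g: "g \<in> carrier G" using assms by (simp add: loxodromic_def)
  obtain x L C where "L \<ge> 1" "C \<ge> 0" and
    L: "\<And>a b::int. dist (real_of_int a) (real_of_int b) / L - C \<le> dist (\<phi> (g [^] a) x) (\<phi> (g [^] b) x) \<and>
          dist (\<phi> (g [^] a) x) (\<phi> (g [^] b) x) \<le> L * dist (real_of_int a) (real_of_int b) + C"
    using assms unfolding loxodromic_def qi_embedding_on_def by blast
  have "dist (real_of_int (- a)) (real_of_int (- b)) = dist (real_of_int a) (real_of_int b)" for a b :: int
    by (simp add: dist_real_def)
  then have "\<And>a b::int. dist (real_of_int a) (real_of_int b) / L - C \<le> dist (\<phi> (inv g [^] a) x) (\<phi> (inv g [^] b) x) \<and>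
          dist (\<phi> (inv g [^] a) x) (\<phi> (inv g [^] b) x) \<le> L * dist (real_of_int a) (real_of_int b) + C"
    using L[of "- a" "- b" for a b] g by (simp add: int_pow_inv int_pow_neg)
  then show ?thesis
    unfolding loxodromic_def qi_embedding_on_def using g \<open>L \<ge> 1\<close> \<open>C \<ge> 0\<close> by blast
qed

lemma loxodromic_dist_at_top:
  assumes "loxodromic G \<phi> g"
  shows "filterlim (\<lambda>n::nat. dist x (\<phi> (g [^] n) x)) at_top sequentially"
proof -
  obtain L C where L: "L \<ge> 1" "C \<ge> 0" "\<And>n::nat. real n / L - C \<le> dist x (\<phi> (g [^] n) x)"
    using loxodromicE[OF assms, of x] by blast
  have "\<exists>N::nat. \<forall>n\<ge>N. Z \<le> dist x (\<phi> (g [^] n) x)" for Z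
  proof -
    obtain N :: nat where N: "L * (Z + C) \<le> real N" using real_arch_simple by blast
    have "Z \<le> dist x (\<phi> (g [^] n) x)" if "n \<ge> N" for n
    proof -
      have "L * (Z + C) \<le> real n" using N that by (meson of_nat_le_iff order_trans)
      then have "Z + C \<le> real n / L" using L(1) by (simp add: field_simps)
      with L(3)[of n] show ?thesis by linarith
    qed
    then show ?thesis by blast
  qed
  then show ?thesis
    unfolding filterlim_at_top eventually_sequentially by blast
qed

text \<open>If doubling the exponent never increased the displacement by a definite amount,
  displacement would grow at most logarithmically.\<close>

lemma loxodromic_doubling:
  assumes "loxodromic G \<phi> g" "K > 0"
  obtains N :: nat where "N > 0" "dist x (\<phi> (g [^] N) x) + K \<le> dist x (\<phi> (g [^] (2 * N)) x)"
proof -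
  define a where "a n = dist x (\<phi> (g [^] n) x)" for n :: nat
  obtain L C where L: "L \<ge> 1" "C \<ge> 0" "\<And>n::nat. real n / L - C \<le> a n"
    using loxodromicE[OF assms(1), of x] unfolding a_def by blast
  have "\<exists>N>0. a N + K \<le> a (2 * N)"
  proof (rule ccontr)
    assume "\<not> ?thesis"
    then have dbl: "a (2 * N) < a N + K" if "N > 0" for N using that by (meson not_le)
    have log: "a (2 ^ j) \<le> a 1 + real j * K" for j
    proof (induction j)
      case (Suc j)
      then show ?case using dbl[of "2 ^ j"] by (simp add: field_simps)
    qed simp
    \<comment> \<open>With \<open>n\<close> at least \<open>Q\<close>, the lower bound
      \<open>(n + 1) * (n + 1)\<close> for \<open>2 ^ (2 * n)\<close> exceeds
      \<open>(n + 1) * Q\<close>, which dominates the bound linear in \<open>n\<close> that follows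
      from \<open>log\<close>.\<close>
    define Q where "Q = L * (C + a 1) + 2 * (K * L)"
    obtain n :: nat where n: "Q \<le> real n" using real_arch_simple by blast
    have "real n + 1 \<le> 2 ^ n"
      using less_exp[of n] by (metis Suc_leI of_nat_Suc of_nat_le_iff of_nat_power of_nat_numeral add.commute)
    then have "(real n + 1) * (real n + 1) \<le> 2 ^ (2 * n)"
      using mult_mono[of "real n + 1" "2 ^ n" "real n + 1" "2 ^ n"] by (simp add: power_add mult_2)
    moreover have "2 ^ (2 * n) / L - C \<le> a 1 + real (2 * n) * K"
      using L(3)[of "2 ^ (2 * n)"] log[of "2 * n"] by simp
    then have "2 ^ (2 * n) \<le> L * (C + a 1) + real n * (2 * (K * L))"
      using L(1) by (simp add: field_simps)
    moreover have "L * (C + a 1) \<ge> 0" "K * L \<ge> 0"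
      using L assms(2) by (auto simp: a_def)
    moreover have "(real n + 1) * (real n + 1) > (real n + 1) * Q"
      using n by simp
    moreover have "(real n + 1) * Q = L * (C + a 1) + real n * (2 * (K * L)) + real n * (L * (C + a 1)) + 2 * (K * L)"
      by (simp add: Q_def algebra_simps)
    ultimately show False
      by (smt (verit) mult_nonneg_nonneg of_nat_0_le_iff)
  qed
  then show ?thesis using that unfolding a_def by blast
qed

text \<open>A suitable power \<open>g [^] N\<close> has an orbit that is a broken path. Every other
  power of \<open>g\<close> brings \<open>x\<close> within a fixed distance of a vertex of this
  path, so the bounded products persist with a larger constant.\<close>

lemma loxodromic_coarse_ray:
  assumes "loxodromic G \<phi> g"
  obtains B where "coarse_ray B (\<lambda>n. \<phi> (g [^] (n::nat)) x)"
proof -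
  have g: "g \<in> carrier G" using assms by (simp add: loxodromic_def)
  define a where "a n = dist x (\<phi> (g [^] n) x)" for n :: nat
  obtain N where N: "N > 0" "a N + (3 * \<delta> + 1) \<le> a (2 * N)"
    using loxodromic_doubling[OF assms, of "3 * \<delta> + 1" x] delta_nonneg unfolding a_def by auto
  \<comment> \<open>This is the product at each vertex of the orbit of \<open>g [^] N\<close>. With
    it the step condition of \<open>broken_path\<close> is exactly the inequality supplied by
    \<open>loxodromic_doubling\<close>.\<close>
  define B where "B = a N - a (2 * N) / 2"
  define f where "f i = \<phi> (g [^] (N * i)) x" for i :: nat
  have d: "dist (f i) (f j) = a (N * (j - i))" if "i \<le> j" for i j
    using that dist_pow_pow[OF g, of "N * i" "N * j"] by (simp add: f_def a_def diff_mult_distrib2)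
  have gp: "gromov_product (f (Suc i)) (f i) (f (Suc (Suc i))) = B" for i
    using d[of i "Suc i"] d[of "Suc i" "Suc (Suc i)"] d[of i "Suc (Suc i)"]
    by (simp add: gromov_product_def B_def dist_commute field_simps)
  have "0 \<le> B" using gp[of 0] gromov_product_nonneg by metis
  then have bp: "broken_path B f n" for n
    using gp d N(2) by (simp add: broken_path_def B_def)
  have near: "dist (f (m div N)) (\<phi> (g [^] m) x) \<le> real N * a 1" for m
  proof -
    have "dist (f (m div N)) (\<phi> (g [^] m) x) = a (m mod N)"
      unfolding f_def a_def using dist_pow_pow[OF g, of "N * (m div N)" m x]
      by (simp add: minus_mult_div_eq_mod)
    also have "\<dots> \<le> real (m mod N) * a 1"
      using dist_pow_le[OF g] g by (simp add: a_def)
    also have "\<dots> \<le> real N * a 1"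
      using N(1) by (intro mult_right_mono) (auto simp: a_def less_imp_le)
    finally show ?thesis .
  qed
  have "gromov_product (\<phi> (g [^] m) x) x (\<phi> (g [^] n) x) \<le> B + 2 * \<delta> + 2 * (real N * a 1)"
    if "m \<le> n" for m n :: nat
  proof -
    have "m div N \<le> n div N" using that by (rule div_le_mono)
    from broken_path_product[OF bp this]
    have "gromov_product (f (m div N)) x (f (n div N)) \<le> B + 2 * \<delta>"
      by (simp add: f_def)
    then show ?thesis
      using gromov_product_perturb[of "\<phi> (g [^] m) x" x "\<phi> (g [^] n) x" "f (m div N)" "f (n div N)"]
        near[of m] near[of n] by (simp add: dist_commute)
  qed
  then have "coarse_ray (B + 2 * \<delta> + 2 * (real N * a 1)) (\<lambda>n. \<phi> (g [^] (n::nat)) x)"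
    using loxodromic_dist_at_top[OF assms] by (simp add: coarse_ray_def)
  then show ?thesis by (rule that)
qed

end

section \<open>Reduced words\<close>

lemma not_successivelyE:
  assumes "\<not> successively P xs"
  obtains as s t bs where "xs = as @ s # t # bs" "\<not> P s t"
proof -
  obtain i where i: "Suc i < length xs" "\<not> P (xs ! i) (xs ! Suc i)"
    using assms by (auto simp: successively_conv_nth)
  then have "xs = take i xs @ xs ! i # xs ! Suc i # drop (Suc (Suc i)) xs"
    by (metis Cons_nth_drop_Suc Suc_lessD append_take_drop_id)
  with i that show ?thesis by blast
qed

lemma successively_concat_replicate:
  assumes "successively P xs" "xs \<noteq> []" "P (last xs) (hd xs)"
  shows "successively P (concat (replicate n xs))"
proof (induction n)
  case (Suc n)
  then show ?case using assms by (cases n) (auto simp: successively_append_iff)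
qed simp

context group
begin

abbreviation word_prod :: "'a list \<Rightarrow> 'a" where
  "word_prod ws \<equiv> foldr (\<otimes>) ws \<one>"

lemma word_prod_closed [simp]: "set ws \<subseteq> carrier G \<Longrightarrow> word_prod ws \<in> carrier G"
  by (induction ws) auto

lemma word_prod_append:
  "set us \<subseteq> carrier G \<Longrightarrow> set ws \<subseteq> carrier G \<Longrightarrow> word_prod (us @ ws) = word_prod us \<otimes> word_prod ws"
proof (induction us)
  case (Cons u us)
  then show ?case by (simp add: m_assoc del: foldr_append)
qed simp

lemma word_prod_power:
  assumes "set ws \<subseteq> carrier G"
  shows "word_prod (concat (replicate n ws)) = word_prod ws [^] n"
proof (induction n)
  case (Suc n)
  have "set (concat (replicate n ws)) \<subseteq> carrier G"
    using assms by (induction n) auto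
  with Suc assms show ?case
    using nat_pow_Suc2[of "word_prod ws" n] word_prod_append[OF assms, of "concat (replicate n ws)"]
    by simp
qed simp

definition letters :: "'a set \<Rightarrow> 'a set" where
  "letters S = S \<union> m_inv G ` S"

text \<open>Cancellation is tested in the group and not on formal symbols, so words are lists of
  group elements and no free group is involved.\<close>

definition reduced :: "'a list \<Rightarrow> bool" where
  "reduced = successively (\<lambda>s t. s \<otimes> t \<noteq> \<one>)"

lemma letters_carrier: "S \<subseteq> carrier G \<Longrightarrow> letters S \<subseteq> carrier G"
  by (auto simp: letters_def)

lemma generate_word:
  assumes "S \<subseteq> carrier G" "a \<in> generate G S"
  shows "\<exists>ws. set ws \<subseteq> letters S \<and> word_prod ws = a"
  using assms(2)
proof induction
  case one
  show ?case by (rule exI[of _ "[]"]) simp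
next
  case (incl h)
  then show ?case using assms(1) by (intro exI[of _ "[h]"]) (auto simp: letters_def)
next
  case (inv h)
  then show ?case using assms(1) by (intro exI[of _ "[inv h]"]) (auto simp: letters_def)
next
  case (eng h1 h2)
  then obtain us ws where "set us \<subseteq> letters S" "word_prod us = h1" "set ws \<subseteq> letters S" "word_prod ws = h2"
    by blast
  then show ?case
    using word_prod_append[of us ws] letters_carrier[OF assms(1)] by (intro exI[of _ "us @ ws"]) auto
qed

lemma cancel_word_prod:
  assumes "set (as @ s # t # bs) \<subseteq> carrier G" "s \<otimes> t = \<one>"
  shows "word_prod (as @ s # t # bs) = word_prod (as @ bs)"
proof -
  have "s \<otimes> (t \<otimes> word_prod bs) = word_prod bs"
    using assms by (simp flip: m_assoc)
  then show ?thesis by simp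
qed

text \<open>A shortest word is reduced, because an adjacent cancelling pair could be
  deleted.\<close>

lemma word_length_reduced:
  assumes "S \<subseteq> carrier G" "a \<in> generate G S"
  obtains ws where "set ws \<subseteq> letters S" "word_prod ws = a" "reduced ws" "length ws = word_length G S a"
proof -
  let ?P = "\<lambda>n. \<exists>ws. length ws = n \<and> set ws \<subseteq> letters S \<and> word_prod ws = a"
  have wl: "word_length G S a = (LEAST n. ?P n)"
    by (simp add: word_length_def letters_def)
  have "\<exists>n. ?P n" using generate_word[OF assms] by blast
  then obtain ws where ws: "length ws = word_length G S a" "set ws \<subseteq> letters S" "word_prod ws = a"
    unfolding wl by (smt (verit) LeastI_ex)
  have "reduced ws"
  proof (rule ccontr)
    assume "\<not> reduced ws"
    then obtain as s t bs where split: "ws = as @ s # t # bs" "s \<otimes> t = \<one>"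
      unfolding reduced_def by (blast elim: not_successivelyE)
    have "set ws \<subseteq> carrier G" using ws(2) letters_carrier[OF assms(1)] by blast
    then have "?P (length (as @ bs))"
      using cancel_word_prod[of as s t bs] ws split by (intro exI[of _ "as @ bs"]) auto
    then have "word_length G S a \<le> length (as @ bs)"
      unfolding wl by (rule Least_le)
    then show False using ws(1) split(1) by simp
  qed
  with ws that show ?thesis by blast
qed

text \<open>The word is chosen shortest among all words for all conjugates of \<open>g\<close>. An
  inner cancellation, or one between the last and the first letter after conjugating, would shorten
  it.\<close>

lemma cyclically_reduced_conjugate:
  assumes S: "S \<subseteq> carrier G" and g: "g \<in> generate G S" "g \<noteq> \<one>"
    and sq: "\<And>s. s \<in> letters S \<Longrightarrow> s \<otimes> s \<noteq> \<one>"
  obtains ws u where "set ws \<subseteq> letters S" "u \<in> carrier G" "word_prod ws = inv u \<otimes> g \<otimes> u"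
    "ws \<noteq> []" "reduced ws" "last ws \<otimes> hd ws \<noteq> \<one>"
proof -
  let ?P = "\<lambda>n. \<exists>ws u. length ws = n \<and> set ws \<subseteq> letters S \<and> u \<in> carrier G \<and> word_prod ws = inv u \<otimes> g \<otimes> u"
  have gc: "g \<in> carrier G" using g(1) generate_in_carrier[OF S] by blast
  have "\<exists>n. ?P n"
  proof -
    obtain ws where "set ws \<subseteq> letters S" "word_prod ws = g" using generate_word[OF S g(1)] by blast
    with gc have "?P (length ws)" by (intro exI[of _ ws] exI[of _ \<one>]) simp
    then show ?thesis by blast
  qed
  define n where "n = (LEAST n. ?P n)"
  have "?P n" unfolding n_def using \<open>\<exists>n. ?P n\<close> by (rule LeastI_ex)
  then obtain ws u where ws: "length ws = n" "set ws \<subseteq> letters S" "u \<in> carrier G" "word_prod ws = inv u \<otimes> g \<otimes> u"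
    by blast
  have minimal: "n \<le> length vs" if "set vs \<subseteq> letters S" "v \<in> carrier G" "word_prod vs = inv v \<otimes> g \<otimes> v" for vs v
    unfolding n_def by (rule Least_le) (use that in blast)
  have wsc: "set ws \<subseteq> carrier G" using ws(2) letters_carrier[OF S] by blast
  have "ws \<noteq> []"
  proof
    assume "ws = []"
    then have "u \<otimes> (inv u \<otimes> g \<otimes> u) = u" using ws(3) by (simp flip: ws(4))
    moreover have "u \<otimes> (inv u \<otimes> g \<otimes> u) = g \<otimes> u"
      using ws(3) gc by (simp add: m_assoc[symmetric])
    ultimately have "g \<otimes> u = u" by simp
    then show False using g(2) ws(3) gc by (metis r_cancel_one)
  qed
  moreover have "reduced ws"
  proof (rule ccontr)
    assume "\<not> reduced ws"
    then obtain as s t bs where split: "ws = as @ s # t # bs" "s \<otimes> t = \<one>"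
      unfolding reduced_def by (blast elim: not_successivelyE)
    then have "word_prod (as @ bs) = inv u \<otimes> g \<otimes> u"
      using cancel_word_prod[of as s t bs] ws wsc by simp
    then show False using minimal[of "as @ bs" u] ws split(1) by auto
  qed
  moreover have "last ws \<otimes> hd ws \<noteq> \<one>"
  proof
    assume cancel: "last ws \<otimes> hd ws = \<one>"
    obtain s vs where sv: "ws = s # vs" using \<open>ws \<noteq> []\<close> by (cases ws) auto
    \<comment> \<open>In a one-letter word the first and last letters coincide, and cancellation
      would contradict \<open>sq\<close>.\<close>
    have "vs \<noteq> []" using cancel sv sq[of s] ws(2) by auto
    then obtain ms t where mt: "vs = ms @ [t]" by (cases vs rule: rev_cases) auto
    have c: "s \<in> carrier G" "t \<in> carrier G" "set ms \<subseteq> carrier G" using wsc sv mt by auto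
    have ts: "t \<otimes> s = \<one>" using cancel sv mt by simp
    \<comment> \<open>Conjugation moves the first letter to the end, next to the letter that it
      cancels.\<close>
    have "inv s \<otimes> word_prod ws \<otimes> s = word_prod (ms @ [t, s])"
      using c sv mt word_prod_append[of ms "[t]"] word_prod_append[of ms "[t, s]"]
      by (simp add: m_assoc del: foldr_append) (simp flip: m_assoc)
    also have "\<dots> = word_prod ms"
      using cancel_word_prod[of ms t s "[]"] c ts by simp
    finally have "word_prod ms = inv s \<otimes> (inv u \<otimes> g \<otimes> u) \<otimes> s" using ws(4) by simp
    also have "\<dots> = inv (u \<otimes> s) \<otimes> g \<otimes> (u \<otimes> s)"
      using c ws(3) gc by (simp add: inv_mult_group m_assoc)
    finally show False
      using minimal[of ms "u \<otimes> s"] ws sv mt c by auto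
  qed
  ultimately show ?thesis using that ws by blast
qed

end

section \<open>From acylindricity to WPD, and subgroups whose reduced words trace broken
  paths\<close>

context hyperbolic_action
begin

text \<open>High powers of \<open>g\<close> move \<open>x\<close> arbitrarily far within its
  \<open>H\<close>-orbit, so acylindricity applies to \<open>x\<close> and such an image. Passing
  from \<open>y\<close> to \<open>x\<close> enlarges displacements by at most
  \<open>2 * dist x y\<close>.\<close>

lemma acylindrical_loxodromic_WPD:
  assumes acyl: "acylindrical_along_set G \<phi> ((\<lambda>h. \<phi> h x) ` H)"
    and H: "subgroup H G" "g \<in> H" and lox: "loxodromic G \<phi> g"
  shows "WPD G \<phi> g"
  unfolding WPD_def
proof (intro allI impI)
  fix y \<epsilon> assume "(0::real) \<le> \<epsilon>"
  define e where "e = \<epsilon> + 2 * dist x y"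
  have "e \<ge> 0" using \<open>0 \<le> \<epsilon>\<close> by (simp add: e_def)
  then obtain R where R: "\<And>p q. p \<in> (\<lambda>h. \<phi> h x) ` H \<Longrightarrow> q \<in> (\<lambda>h. \<phi> h x) ` H \<Longrightarrow> R \<le> dist p q \<Longrightarrow>
      finite (coarse_stab e p q)"
    using acyl unfolding acylindrical_along_set_def coarse_stab_def by blast
  obtain N :: nat where N: "\<And>n. n \<ge> N \<Longrightarrow> R \<le> dist x (\<phi> (g [^] n) x)"
    using loxodromic_dist_at_top[OF lox, of x]
    unfolding filterlim_at_top eventually_sequentially by blast
  have pow: "g [^] n \<in> H" for n :: nat
    using H by (induction n) (auto simp: subgroup.one_closed subgroup.m_closed)
  have carr: "g [^] n \<in> carrier G" for n :: nat
    using pow H(1) subgroup.mem_carrier by metis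
  have "x \<in> (\<lambda>h. \<phi> h x) ` H"
    using subgroup.one_closed[OF H(1)] act_one by (metis image_eqI)
  \<comment> \<open>The exponent is \<open>Suc N\<close> because WPD requires a positive
    one.\<close>
  then have fin: "finite (coarse_stab e x (\<phi> (g [^] Suc N) x))"
    using pow[of "Suc N"] N[of "Suc N"] by (intro R) auto
  have move: "dist (\<phi> \<gamma> (\<phi> k x)) (\<phi> k x) \<le> e"
    if "\<gamma> \<in> carrier G" "k \<in> carrier G" "dist (\<phi> k y) (\<phi> \<gamma> (\<phi> k y)) \<le> \<epsilon>" for \<gamma> k
  proof -
    have "dist (\<phi> \<gamma> (\<phi> k x)) (\<phi> \<gamma> (\<phi> k y)) = dist x y" "dist (\<phi> k y) (\<phi> k x) = dist x y"
      using that by (simp_all add: dist_commute)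
    then show ?thesis
      using that(3) dist_triangle[of "\<phi> \<gamma> (\<phi> k x)" "\<phi> k x" "\<phi> \<gamma> (\<phi> k y)"]
        dist_triangle[of "\<phi> \<gamma> (\<phi> k y)" "\<phi> k x" "\<phi> k y"]
      by (simp add: e_def dist_commute)
  qed
  have "{\<gamma> \<in> carrier G. dist y (\<phi> \<gamma> y) \<le> \<epsilon> \<and>
      dist (\<phi> (g [^] Suc N) y) (\<phi> \<gamma> (\<phi> (g [^] Suc N) y)) \<le> \<epsilon>}
    \<subseteq> coarse_stab e x (\<phi> (g [^] Suc N) x)"
    unfolding coarse_stab_def using move[of _ \<one>] move[OF _ carr[of "Suc N"]] by auto
  with fin show "\<exists>N::nat. N > 0 \<and> finite {\<gamma> \<in> carrier G. dist y (\<phi> \<gamma> y) \<le> \<epsilon> \<and>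
      dist (\<phi> (g [^] N) y) (\<phi> \<gamma> (\<phi> (g [^] N) y)) \<le> \<epsilon>}"
    by (intro exI[of _ "Suc N"]) (auto intro: finite_subset)
qed

end

text \<open>The constant in \<open>stab\<close> depends only on the turning bound and on \<open>\<delta>\<close>, but not on the letters
  nor on the displacement in the definition of acylindricity.\<close>

locale broken_letters = hyperbolic_action X \<delta> G \<phi>
  for X :: "'x::metric_space itself" and \<delta> and G :: "('g, 'm) monoid_scheme" (structure)
    and \<phi> :: "'g \<Rightarrow> 'x \<Rightarrow> 'x" +
  fixes x :: 'x and B :: real and S :: "'g set"
  assumes finite_S: "finite S" and S_carrier: "S \<subseteq> carrier G" and S_nonempty: "S \<noteq> {}"
    and B_nonneg: "0 \<le> B"
    and step: "\<And>s. s \<in> letters S \<Longrightarrow> 2 * B + 3 * \<delta> + 1 \<le> dist x (\<phi> s x)"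
    and turn: "\<And>s t. s \<in> letters S \<Longrightarrow> t \<in> letters S \<Longrightarrow> s \<otimes> t \<noteq> \<one> \<Longrightarrow>
      gromov_product x (\<phi> (inv s) x) (\<phi> t x) \<le> B"
    and no_involution: "\<And>s. s \<in> letters S \<Longrightarrow> s \<otimes> s \<noteq> \<one>"
    and stab: "\<And>s. s \<in> S \<Longrightarrow> finite (coarse_stab (2 * B + 10 * \<delta> + 1) x (\<phi> s x))"
begin

abbreviation H :: "'g set" where
  "H \<equiv> generate G S"

text \<open>The orbit image of a path in the Cayley graph: taking prefixes makes consecutive
  vertices a common translate of \<open>x\<close> and \<open>\<phi> s x\<close> for a letter
  \<open>s\<close>.\<close>

definition word_path :: "'g list \<Rightarrow> nat \<Rightarrow> 'x" where
  "word_path ws i = \<phi> (word_prod (take i ws)) x"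

lemma letter_closed: "s \<in> letters S \<Longrightarrow> s \<in> carrier G"
  using letters_carrier[OF S_carrier] by blast

lemma word_closed: "set ws \<subseteq> letters S \<Longrightarrow> set ws \<subseteq> carrier G"
  using letter_closed by blast

lemma prefix_closed: "set ws \<subseteq> letters S \<Longrightarrow> word_prod (take i ws) \<in> carrier G"
  by (meson set_take_subset subset_trans word_closed word_prod_closed)

lemma H_subgroup: "subgroup H G"
  using S_carrier by (rule generate_is_subgroup)

lemma H_closed: "a \<in> H \<Longrightarrow> a \<in> carrier G"
  using H_subgroup by (rule subgroup.mem_carrier)

lemma word_path_0 [simp]: "word_path ws 0 = x"
  by (simp add: word_path_def)

lemma word_path_length [simp]: "word_path ws (length ws) = \<phi> (word_prod ws) x"
  by (simp add: word_path_def)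

lemma word_path_Suc:
  assumes "set ws \<subseteq> letters S" "i < length ws"
  shows "word_path ws (Suc i) = \<phi> (word_prod (take i ws)) (\<phi> (ws ! i) x)"
proof -
  have s: "ws ! i \<in> carrier G" using assms letter_closed nth_mem by blast
  have "word_prod (take (Suc i) ws) = word_prod (take i ws) \<otimes> ws ! i"
    using word_prod_append[of "take i ws" "[ws ! i]"] s word_closed[OF assms(1)] assms(2)
      set_take_subset[of i ws]
    by (simp add: take_Suc_conv_app_nth del: foldr_append)
  then show ?thesis
    using s prefix_closed[OF assms(1)] by (simp add: word_path_def act_mult)
qed

text \<open>Translated back to \<open>x\<close>, the corner between letters \<open>s\<close> and
  \<open>t\<close> is the product of \<open>\<phi> (inv s) x\<close> and \<open>\<phi> t x\<close>,
  which \<open>turn\<close> bounds as \<open>s\<close> and \<open>t\<close> do not cancel.\<close>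

lemma reduced_broken_path:
  assumes "set ws \<subseteq> letters S" "reduced ws"
  shows "broken_path B (word_path ws) (length ws)"
  unfolding broken_path_def
proof (intro conjI allI impI B_nonneg)
  fix i
  show "2 * B + 3 * \<delta> + 1 \<le> dist (word_path ws i) (word_path ws (Suc i))" if "i < length ws"
    using that step[of "ws ! i"] assms(1) prefix_closed[OF assms(1)]
    by (auto simp: word_path_Suc[OF assms(1)]) (simp add: word_path_def subset_iff)
  show "gromov_product (word_path ws (Suc i)) (word_path ws i) (word_path ws (Suc (Suc i))) \<le> B"
    if i: "Suc i < length ws"
  proof -
    define P where "P = word_prod (take (Suc i) ws)"
    have P: "P \<in> carrier G" unfolding P_def by (rule prefix_closed[OF assms(1)])
    have l: "ws ! i \<in> letters S" "ws ! Suc i \<in> letters S"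
      using i assms(1) by (auto simp: subset_iff)
    have "word_path ws (Suc i) = \<phi> P x" by (simp add: word_path_def P_def)
    moreover have "word_path ws (Suc (Suc i)) = \<phi> P (\<phi> (ws ! Suc i) x)"
      using word_path_Suc[OF assms(1) i] by (simp add: P_def)
    moreover have "word_path ws i = \<phi> P (\<phi> (inv (ws ! i)) x)"
    proof -
      have Q: "word_prod (take i ws) \<in> carrier G" by (rule prefix_closed[OF assms(1)])
      have "word_prod (take i ws) \<otimes> ws ! i = P"
        using word_prod_append[of "take i ws" "[ws ! i]"] letter_closed[OF l(1)] word_closed[OF assms(1)] i
          set_take_subset[of i ws]
        by (simp add: P_def take_Suc_conv_app_nth del: foldr_append)
      then have "P \<otimes> inv (ws ! i) = word_prod (take i ws)"
        using letter_closed[OF l(1)] Q by (auto simp: m_assoc)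
      then show ?thesis
        using P letter_closed[OF l(1)] by (simp add: word_path_def flip: act_mult)
    qed
    moreover have "ws ! i \<otimes> ws ! Suc i \<noteq> \<one>"
      using successively_nth[OF assms(2)[unfolded reduced_def] i] .
    ultimately show ?thesis using turn[OF l] P by simp
  qed
qed

lemma reduced_length_le:
  assumes "set ws \<subseteq> letters S" "reduced ws"
  shows "real (length ws) \<le> dist x (\<phi> (word_prod ws) x)"
  using broken_path_length[OF reduced_broken_path[OF assms]] by simp

lemma word_length_le:
  assumes "a \<in> H"
  shows "real (word_length G S a) \<le> dist x (\<phi> a x)"
  by (metis word_length_reduced[OF S_carrier assms] reduced_length_le)

definition max_step :: real where
  "max_step = Max ((\<lambda>s. dist x (\<phi> s x)) ` letters S)"

lemma finite_letters: "finite (letters S)"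
  using finite_S by (simp add: letters_def)

lemma dist_letter_le: "s \<in> letters S \<Longrightarrow> dist x (\<phi> s x) \<le> max_step"
  unfolding max_step_def using finite_letters by simp

lemma max_step_nonneg: "0 \<le> max_step"
proof -
  obtain s where "s \<in> letters S" using S_nonempty by (auto simp: letters_def)
  then show ?thesis using dist_letter_le zero_le_dist order_trans by blast
qed

lemma dist_word_le:
  assumes "set ws \<subseteq> letters S"
  shows "dist x (\<phi> (word_prod ws) x) \<le> max_step * real (length ws)"
  using assms
proof (induction ws)
  case (Cons s ws)
  have c: "s \<in> carrier G" "word_prod ws \<in> carrier G"
    using Cons.prems letter_closed word_closed[of ws] by auto
  have "dist x (\<phi> (word_prod (s # ws)) x) \<le> dist x (\<phi> s x) + dist (\<phi> s x) (\<phi> s (\<phi> (word_prod ws) x))"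
    using c dist_triangle by (simp add: act_mult del: act_dist)
  then show ?case
    using Cons c dist_letter_le[of s] by (simp add: algebra_simps)
qed simp

lemma dist_word_length_le:
  assumes "a \<in> H"
  shows "dist x (\<phi> a x) \<le> max_step * real (word_length G S a)"
  by (metis word_length_reduced[OF S_carrier assms] dist_word_le)

lemma orbit_dist:
  assumes "a \<in> H" "b \<in> H"
  shows "dist (\<phi> a x) (\<phi> b x) = dist x (\<phi> (inv a \<otimes> b) x)"
  using assms[THEN H_closed] by (simp add: act_mult dist_act_left)

lemma H_quotient: "a \<in> H \<Longrightarrow> b \<in> H \<Longrightarrow> inv a \<otimes> b \<in> H"
  using H_subgroup by (simp add: subgroup.m_closed subgroup.m_inv_closed)

lemma H_qi_embedded: "qi_embedded_by_action G \<phi> H"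
proof -
  define L where "L = max 1 max_step"
  have L: "L \<ge> 1" "L \<ge> max_step" by (simp_all add: L_def)
  have "word_dist G S a b / L - 0 \<le> dist (\<phi> a x) (\<phi> b x) \<and>
      dist (\<phi> a x) (\<phi> b x) \<le> L * word_dist G S a b + 0" if ab: "a \<in> H" "b \<in> H" for a b
  proof
    define n where "n = real (word_length G S (inv a \<otimes> b))"
    have n: "0 \<le> n" "n \<le> dist (\<phi> a x) (\<phi> b x)" "dist (\<phi> a x) (\<phi> b x) \<le> max_step * n"
      using word_length_le[OF H_quotient[OF ab]] dist_word_length_le[OF H_quotient[OF ab]]
      by (simp_all add: n_def orbit_dist[OF ab])
    have "n / L \<le> n" using L(1) n(1) mult_left_mono[of 1 L n] by (simp add: divide_le_eq)
    then show "word_dist G S a b / L - 0 \<le> dist (\<phi> a x) (\<phi> b x)"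
      using n(2) by (simp add: word_dist_def n_def)
    have "max_step * n \<le> L * n" using L(2) n(1) by (rule mult_right_mono)
    then show "dist (\<phi> a x) (\<phi> b x) \<le> L * word_dist G S a b + 0"
      using n(3) by (simp add: word_dist_def n_def)
  qed
  with L(1) have "qi_embedding_on H (word_dist G S) (\<lambda>h. \<phi> h x)"
    unfolding qi_embedding_on_def by blast
  then show ?thesis
    unfolding qi_embedded_by_action_def finite_generating_set_def
    using finite_S S_carrier by blast
qed

text \<open>Repeating a cyclically reduced word keeps it reduced, so the powers of a conjugate of
  \<open>g\<close> displace \<open>x\<close> linearly. The base point \<open>\<phi> u x\<close>
  undoes the conjugation.\<close>

lemma H_loxodromic:
  assumes "g \<in> H" "g \<noteq> \<one>"
  shows "loxodromic G \<phi> g"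
proof -
  obtain ws u where ws: "set ws \<subseteq> letters S" "u \<in> carrier G" "word_prod ws = inv u \<otimes> g \<otimes> u"
    "ws \<noteq> []" "reduced ws" "last ws \<otimes> hd ws \<noteq> \<one>"
    using cyclically_reduced_conjugate[OF S_carrier assms no_involution] by blast
  have g: "g \<in> carrier G" using assms(1) by (rule H_closed)
  have wc: "word_prod ws \<in> carrier G" using ws(1) word_closed by simp
  have pow: "g [^] n \<otimes> u = u \<otimes> word_prod ws [^] n" for n :: nat
  proof (induction n)
    case (Suc n)
    have gu: "g \<otimes> u = u \<otimes> word_prod ws"
      using ws(2,3) g by (simp add: m_assoc[symmetric])
    have "g [^] Suc n \<otimes> u = (g [^] n \<otimes> u) \<otimes> word_prod ws"
      using g ws(2) wc by (simp add: m_assoc gu)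
    then show ?case using Suc ws(2) wc by (simp add: m_assoc)
  qed (use ws(2) in simp)
  have "real n \<le> dist (\<phi> u x) (\<phi> (g [^] n) (\<phi> u x))" for n :: nat
  proof -
    have len: "n \<le> length (concat (replicate n ws))"
      using ws(4) by (simp add: length_concat sum_list_replicate Suc_le_eq)
    have "real (length (concat (replicate n ws))) \<le> dist x (\<phi> (word_prod (concat (replicate n ws))) x)"
    proof (rule reduced_length_le)
      show "set (concat (replicate n ws)) \<subseteq> letters S" using ws(1) by (induction n) auto
      show "reduced (concat (replicate n ws))"
        unfolding reduced_def using ws by (intro successively_concat_replicate) (auto simp: reduced_def)
    qed
    then have "real n \<le> dist x (\<phi> (word_prod ws [^] n) x)"
      using len word_prod_power[OF word_closed[OF ws(1)], of n] by simp
    also have "\<dots> = dist (\<phi> u x) (\<phi> (u \<otimes> word_prod ws [^] n) x)"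
      using ws(2) wc by (simp add: act_mult)
    also have "\<dots> = dist (\<phi> u x) (\<phi> (g [^] n) (\<phi> u x))"
      using g ws(2) by (simp add: act_mult flip: pow)
    finally show ?thesis .
  qed
  then show ?thesis by (rule loxodromicI[OF g])
qed

text \<open>The powers of a single generator already have an unbounded orbit.\<close>

lemma H_infinite: "infinite H"
proof
  assume fin: "finite H"
  obtain s where s: "s \<in> S" using S_nonempty by blast
  then have l: "s \<in> letters S" by (simp add: letters_def)
  have "s \<noteq> \<one>" using no_involution[OF l] by auto
  then have lox: "loxodromic G \<phi> s" using s by (intro H_loxodromic generate.incl)
  have "s [^] n \<in> H" for n :: nat
    by (induction n) (auto intro: generate.one generate.incl generate.eng s)
  then have "dist x (\<phi> (s [^] n) x) \<le> Max ((\<lambda>a. dist x (\<phi> a x)) ` H)" for n :: nat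
    using fin by simp
  moreover obtain N where "\<And>n. n \<ge> N \<Longrightarrow> Max ((\<lambda>a. dist x (\<phi> a x)) ` H) + 1 \<le> dist x (\<phi> (s [^] (n::nat)) x)"
    using loxodromic_dist_at_top[OF lox, of x]
    unfolding filterlim_at_top eventually_sequentially by meson
  ultimately show False by (metis add_le_same_cancel1 not_one_le_zero order_refl order_trans)
qed

text \<open>The word has a middle letter with \<open>a\<close> letters on either side. Infinitely
  many coarse stabilizers of the ends would yield infinitely many of the middle letter, with the
  constant of \<open>stab\<close> in place of \<open>e\<close>.\<close>

lemma finite_coarse_stab_word:
  assumes ws: "set ws \<subseteq> letters S" "reduced ws"
    and a: "e + B + 4 * \<delta> < real a" "length ws = 2 * a + 1"
  shows "finite (coarse_stab e x (\<phi> (word_prod ws) x))"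
proof (rule ccontr)
  define n where "n = length ws"
  define f where "f = word_path ws"
  have bp: "broken_path B f n" unfolding n_def f_def by (rule reduced_broken_path[OF ws])
  have ends: "x = f 0" "\<phi> (word_prod ws) x = f n" by (simp_all add: f_def n_def)
  define F where "F = coarse_stab e (f 0) (f n)"
  assume "\<not> finite (coarse_stab e x (\<phi> (word_prod ws) x))"
  then have "infinite F" by (metis F_def ends)
  have F: "\<gamma> \<in> carrier G" "dist (f 0) (\<phi> \<gamma> (f 0)) \<le> e" "dist (f n) (\<phi> \<gamma> (f n)) \<le> e" if "\<gamma> \<in> F" for \<gamma>
    using that by (auto simp: F_def coarse_stab_def dist_commute)
  \<comment> \<open>The rounded position of a moved vertex along the path; on the two ends of the
    middle letter it takes finitely many values.\<close>
  define shadow where "shadow \<gamma> j = \<lfloor>dist (f 0) (\<phi> \<gamma> (f j))\<rfloor>" for \<gamma> j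
  define K where "K = max (dist (f 0) (f a)) (dist (f 0) (f (Suc a))) + e"
  have shadow_range: "shadow \<gamma> j \<in> {0..\<lfloor>K\<rfloor>}" if "\<gamma> \<in> F" "j = a \<or> j = Suc a" for \<gamma> j
  proof -
    have "dist (f 0) (\<phi> \<gamma> (f j)) \<le> dist (f 0) (\<phi> \<gamma> (f 0)) + dist (\<phi> \<gamma> (f 0)) (\<phi> \<gamma> (f j))"
      by (rule dist_triangle)
    also have "\<dots> \<le> K" using F[OF that(1)] that(2) by (auto simp: K_def)
    finally show ?thesis by (simp add: shadow_def floor_mono)
  qed
  have "(\<lambda>\<gamma>. (shadow \<gamma> a, shadow \<gamma> (Suc a))) ` F \<subseteq> {0..\<lfloor>K\<rfloor>} \<times> {0..\<lfloor>K\<rfloor>}"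
    using shadow_range by blast
  then have "finite ((\<lambda>\<gamma>. (shadow \<gamma> a, shadow \<gamma> (Suc a))) ` F)"
    by (rule finite_subset) simp
  from pigeonhole_infinite[OF \<open>infinite F\<close> this]
  obtain \<gamma>0 where \<gamma>0: "\<gamma>0 \<in> F" and
    inf: "infinite {\<gamma> \<in> F. (shadow \<gamma> a, shadow \<gamma> (Suc a)) = (shadow \<gamma>0 a, shadow \<gamma>0 (Suc a))}"
    by blast
  define F' where "F' = {\<gamma> \<in> F. (shadow \<gamma> a, shadow \<gamma> (Suc a)) = (shadow \<gamma>0 a, shadow \<gamma>0 (Suc a))}"
  \<comment> \<open>A moved middle vertex stays coarsely between the unmoved ends: the assumption on
    \<open>a\<close> puts it far enough from the moved ends for
    \<open>gromov_product_move_ends\<close>.\<close>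
  have product: "gromov_product (\<phi> \<gamma> (f j)) (f 0) (f n) \<le> B + 4 * \<delta>"
    if "\<gamma> \<in> F" "a \<le> j" "j \<le> Suc a" for \<gamma> j
  proof -
    have jn: "j \<le> n" using that a(2) by (simp add: n_def)
    have "real j \<le> dist (f 0) (f j)" using broken_path_dist[OF bp, of 0 j] jn by simp
    moreover have "real (n - j) \<le> dist (f j) (f n)" using broken_path_dist[OF bp, of j n] jn by simp
    moreover have "a \<le> n - j" using that a(2) by (simp add: n_def)
    ultimately have "real a \<le> dist (f 0) (f j)" "real a \<le> dist (f n) (f j)"
      using that(2) by (simp_all add: dist_commute)
    then have "gromov_product (\<phi> \<gamma> (f j)) (f 0) (f n) \<le> (B + 2 * \<delta>) + 2 * \<delta>"
      using broken_path_product[OF bp jn] F[OF that(1)] a(1)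
      
      by - (rule gromov_product_move_ends[where p' = "\<phi> \<gamma> (f 0)" and q' = "\<phi> \<gamma> (f n)" and e = e], auto)
    then show ?thesis by simp
  qed
  \<comment> \<open>This is \<open>2 * b + 2 * \<delta> + e\<close> from
    \<open>dist_same_shadow\<close> with \<open>b = B + 4 * \<delta>\<close> and rounding error
    1.\<close>
  define c where "c = 2 * B + 10 * \<delta> + 1"
  have same: "dist (\<phi> \<gamma> (f j)) (\<phi> \<gamma>0 (f j)) \<le> c" if "\<gamma> \<in> F'" "j = a \<or> j = Suc a" for \<gamma> j
  proof -
    have "\<gamma> \<in> F" "shadow \<gamma> j = shadow \<gamma>0 j" using that by (auto simp: F'_def)
    then have "\<bar>dist (f 0) (\<phi> \<gamma> (f j)) - dist (f 0) (\<phi> \<gamma>0 (f j))\<bar> \<le> 1"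
      unfolding shadow_def by linarith
    moreover have "a \<le> j" "j \<le> Suc a" using that(2) by auto
    ultimately have "dist (\<phi> \<gamma> (f j)) (\<phi> \<gamma>0 (f j)) \<le> 2 * (B + 4 * \<delta>) + 2 * \<delta> + 1"
      using product \<open>\<gamma> \<in> F\<close> \<gamma>0 by (intro dist_same_shadow) auto
    then show ?thesis by (simp add: c_def)
  qed
  \<comment> \<open>Elements with equal shadows nearly agree on both ends of the middle letter, so
    their quotients nearly fix these ends.\<close>
  have "(\<lambda>\<gamma>. inv \<gamma>0 \<otimes> \<gamma>) ` F' \<subseteq> coarse_stab c (f a) (f (Suc a))"
  proof
    fix \<beta> assume "\<beta> \<in> (\<lambda>\<gamma>. inv \<gamma>0 \<otimes> \<gamma>) ` F'"
    then obtain \<gamma> where \<gamma>: "\<gamma> \<in> F'" "\<beta> = inv \<gamma>0 \<otimes> \<gamma>" by blast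
    then have "\<gamma> \<in> carrier G" using F by (simp add: F'_def)
    then show "\<beta> \<in> coarse_stab c (f a) (f (Suc a))"
      using same[OF \<gamma>(1)] F(1)[OF \<gamma>0] \<gamma>(2) by (simp add: coarse_stab_def act_mult dist_act_left[of "inv \<gamma>0"])
  qed
  moreover have "infinite ((\<lambda>\<gamma>. inv \<gamma>0 \<otimes> \<gamma>) ` F')"
  proof -
    have "inj_on (\<lambda>\<gamma>. inv \<gamma>0 \<otimes> \<gamma>) F'"
      by (rule inj_on_subset[OF inj_on_cmult]) (use F \<gamma>0 in \<open>auto simp: F'_def\<close>)
    then show ?thesis using inf finite_imageD unfolding F'_def by blast
  qed
  ultimately have "infinite (coarse_stab c (f a) (f (Suc a)))"
    using finite_subset by blast
  moreover have "finite (coarse_stab c (f a) (f (Suc a)))"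
  proof -
    define P s where "P = word_prod (take a ws)" and "s = ws ! a"
    have a_lt: "a < length ws" using a(2) by simp
    have P: "P \<in> carrier G" unfolding P_def by (rule prefix_closed[OF ws(1)])
    have s: "s \<in> letters S" using ws(1) a_lt by (auto simp: s_def subset_iff)
    \<comment> \<open>For an inverse letter \<open>inv t\<close> the pair is the translate by
      \<open>inv t\<close> of the pair of \<open>t\<close>, with its ends exchanged.\<close>
    have "finite (coarse_stab c x (\<phi> s x))"
    proof (cases "s \<in> S")
      case True
      then show ?thesis using stab by (simp add: c_def)
    next
      case False
      then obtain t where t: "t \<in> S" "s = inv t" using s by (auto simp: letters_def)
      then have tc: "t \<in> carrier G" using S_carrier by blast
      then have "finite (coarse_stab c (\<phi> s (\<phi> t x)) (\<phi> s x))"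
        using stab[OF t(1)] t(2) coarse_stab_commute unfolding c_def
        by (intro coarse_stab_translate(1)) auto
      then show ?thesis using t tc by simp
    qed
    then have "finite (coarse_stab c (\<phi> P x) (\<phi> P (\<phi> s x)))"
      by (rule coarse_stab_translate(1)[OF P])
    then show ?thesis
      using word_path_Suc[OF ws(1) a_lt] by (simp add: f_def word_path_def P_def s_def)
  qed
  ultimately show False by blast
qed

text \<open>After translation one point is \<open>x\<close>, and a distant second point has a long
  reduced word. Its prefix of length \<open>n\<close> ends coarsely between the two points, and
  there are only finitely many such prefixes.\<close>

lemma H_acylindrical: "acylindrical_along_set G \<phi> ((\<lambda>h. \<phi> h x) ` H)"
  unfolding acylindrical_along_set_def
proof (intro allI impI)
  fix \<epsilon> :: real assume "\<epsilon> \<ge> 0"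
  \<comment> \<open>The enlarged displacement from \<open>coarse_stab_between\<close> with the
    product bound \<open>B + 2 * \<delta>\<close>.\<close>
  define e where "e = \<epsilon> + 2 * (B + 2 * \<delta>) + 2 * \<delta>"
  obtain a :: nat where a: "e + B + 4 * \<delta> < real a" using reals_Archimedean2 by blast
  define n where "n = 2 * a + 1"
  define W where "W = {ws. set ws \<subseteq> letters S \<and> length ws = n}"
  have "finite W" unfolding W_def by (rule finite_lists_length_eq[OF finite_letters])
  \<comment> \<open>The sum dominates each of its terms. Non-reduced words in \<open>W\<close> may
    have infinite coarse stabilizers, which contribute cardinality 0.\<close>
  define M where "M = Suc (\<Sum>ws\<in>W. card (coarse_stab e x (\<phi> (word_prod ws) x)))"
  \<comment> \<open>Beyond the reach of words with at most \<open>n\<close> letters.\<close>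
  define R where "R = max_step * real n + 1"
  have bound: "finite (coarse_stab \<epsilon> x (\<phi> w x)) \<and> card (coarse_stab \<epsilon> x (\<phi> w x)) \<le> M"
    if w: "w \<in> H" "R \<le> dist x (\<phi> w x)" for w
  proof -
    obtain ws where ws: "set ws \<subseteq> letters S" "word_prod ws = w" "reduced ws"
      using word_length_reduced[OF S_carrier w(1)] by blast
    have "n \<le> length ws"
    proof (rule ccontr)
      assume "\<not> n \<le> length ws"
      then have "max_step * real (length ws) \<le> max_step * real n"
        using max_step_nonneg by (intro mult_left_mono) auto
      then show False using dist_word_le[OF ws(1)] w(2) ws(2) by (simp add: R_def)
    qed
    define vs where "vs = take n ws"
    have vs: "vs \<in> W" "reduced vs" "word_path ws n = \<phi> (word_prod vs) x"
    proof -
      show "vs \<in> W" using ws(1) \<open>n \<le> length ws\<close> set_take_subset[of n ws] by (auto simp: W_def vs_def)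
      show "reduced vs" using ws(3) append_take_drop_id[of n ws]
        unfolding reduced_def vs_def by (metis successively_append_iff)
      show "word_path ws n = \<phi> (word_prod vs) x" by (simp add: word_path_def vs_def)
    qed
    have fin: "finite (coarse_stab e x (\<phi> (word_prod vs) x))"
      using finite_coarse_stab_word[OF _ vs(2) a] vs(1) by (simp add: W_def n_def)
    have "gromov_product (\<phi> (word_prod vs) x) x (\<phi> w x) \<le> B + 2 * \<delta>"
      using broken_path_product[OF reduced_broken_path[OF ws(1,3)] \<open>n \<le> length ws\<close>] ws(2)
      by (simp add: vs(3))
    then have sub: "coarse_stab \<epsilon> x (\<phi> w x) \<subseteq> coarse_stab e x (\<phi> (word_prod vs) x)"
      unfolding e_def by (rule coarse_stab_between)
    have "card (coarse_stab e x (\<phi> (word_prod vs) x)) \<le> M"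
      unfolding M_def using member_le_sum[OF vs(1), of "\<lambda>ws. card (coarse_stab e x (\<phi> (word_prod ws) x))"] \<open>finite W\<close>
      by simp
    then show ?thesis using fin sub card_mono[OF fin sub] finite_subset by auto
  qed
  have "finite (coarse_stab \<epsilon> p q) \<and> card (coarse_stab \<epsilon> p q) \<le> M"
    if pq: "p \<in> (\<lambda>h. \<phi> h x) ` H" "q \<in> (\<lambda>h. \<phi> h x) ` H" "dist p q \<ge> R" for p q
  proof -
    obtain h k where hk: "h \<in> H" "k \<in> H" "p = \<phi> h x" "q = \<phi> k x" using pq by blast
    define w where "w = inv h \<otimes> k"
    have w: "w \<in> H" "R \<le> dist x (\<phi> w x)"
      using hk H_quotient pq(3) orbit_dist by (auto simp: w_def)
    have "q = \<phi> h (\<phi> w x)"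
      using hk H_closed by (simp add: w_def act_mult)
    then show ?thesis
      using coarse_stab_translate[OF H_closed[OF hk(1)], of \<epsilon> x "\<phi> w x"] bound[OF w] hk(3) by auto
  qed
  moreover have "R > 0" using max_step_nonneg by (simp add: R_def add_nonneg_pos)
  moreover have "M > 0" by (simp add: M_def)
  ultimately show "\<exists>R>0. \<exists>M::nat. M > 0 \<and> (\<forall>p\<in>(\<lambda>h. \<phi> h x) ` H. \<forall>q\<in>(\<lambda>h. \<phi> h x) ` H. dist p q \<ge> R \<longrightarrow>
      finite {g \<in> carrier G. dist (\<phi> g p) p \<le> \<epsilon> \<and> dist (\<phi> g q) q \<le> \<epsilon>} \<and>
      card {g \<in> carrier G. dist (\<phi> g p) p \<le> \<epsilon> \<and> dist (\<phi> g q) q \<le> \<epsilon>} \<le> M)"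
    unfolding coarse_stab_def by blast
qed

lemma H_loxodromic_WPD:
  assumes "g \<in> H" "g \<noteq> \<one>"
  shows "loxodromic_WPD G \<phi> g"
  using acylindrical_loxodromic_WPD[OF H_acylindrical H_subgroup assms(1)] H_loxodromic[OF assms]
  by (simp add: loxodromic_WPD_def)

lemma H_AQI_triple:
  assumes "hyperbolic_space TYPE('x)"
  shows "AQI_triple G \<phi> H"
  unfolding AQI_triple_def acylindrical_along_def finite_generating_set_def
  using assms action H_subgroup finite_S S_carrier H_infinite H_acylindrical H_qi_embedded by blast

end

section \<open>High powers of independent loxodromic WPD elements\<close>

context hyperbolic_action
begin

text \<open>Applying \<open>f\<close> shifts the ray by one index, and a sequence converging to
  infinity is equivalent to its shift. For \<open>f = inv g\<close> the relation is then translated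
  by \<open>g\<close>.\<close>

lemma power_ray_endpoint_fixed:
  assumes "loxodromic G \<phi> g" and f: "f = g \<or> f = inv g"
  shows "boundary_rel `` {\<lambda>n::nat. \<phi> (f [^] n) x} \<in> boundary_fixed_points (\<phi> g)"
proof -
  have g: "g \<in> carrier G" using assms(1) by (simp add: loxodromic_def)
  then have fc: "f \<in> carrier G" using f by auto
  define u where "u n = \<phi> (f [^] n) x" for n :: nat
  have "loxodromic G \<phi> f" using assms loxodromic_inv by auto
  then obtain B where "coarse_ray B u"
    unfolding u_def using loxodromic_coarse_ray by blast
  then have conv: "converges_to_infinity u" by (rule coarse_ray_converges)
  have shift: "\<phi> f (u n) = u (Suc n)" for n
    using fc nat_pow_Suc2[OF fc, of n] by (simp add: u_def flip: act_mult)
  have "filterlim (\<lambda>n. gromov_product x (u (Suc n)) (u n)) at_top sequentially"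
    unfolding filterlim_at_top eventually_sequentially
    using converges_to_infinityD[OF conv, of _ x] by (meson le_SucI)
  moreover have "converges_to_infinity (\<phi> f \<circ> u)"
  proof -
    have "(\<phi> f \<circ> u, \<phi> f \<circ> u) \<in> boundary_rel"
      using boundary_rel_isometry[OF boundary_rel_refl[OF conv], of "\<phi> f"] fc by simp
    then show ?thesis by (simp add: boundary_rel_def)
  qed
  ultimately have rel: "(\<phi> f \<circ> u, u) \<in> boundary_rel"
    using conv by (intro boundary_relI[where w = x]) (simp_all add: shift)
  have "(\<phi> g \<circ> u, u) \<in> boundary_rel"
  proof (cases "f = g")
    case False
    then have "\<phi> g \<circ> (\<phi> f \<circ> u) = u" using f g by auto
    then show ?thesis
      using boundary_rel_isometry[OF boundary_rel_sym[OF rel], of "\<phi> g"] g by simp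
  qed (use rel in simp)
  then have "boundary_rel `` {u} \<in> boundary_fixed_points (\<phi> g)"
    by (rule boundary_fixed_pointI[where f' = "\<phi> (inv g)"]) (use g in auto)
  then show ?thesis by (simp add: u_def[abs_def])
qed

text \<open>Unbounded products would make the two rays asymptotic, and their common endpoint would
  be fixed by both \<open>g\<close> and \<open>h\<close>.\<close>

lemma independent_powers_product_bounded:
  assumes "loxodromic G \<phi> g" "loxodromic G \<phi> h"
    and disj: "boundary_fixed_points (\<phi> g) \<inter> boundary_fixed_points (\<phi> h) = {}"
    and a: "a = g \<or> a = inv g" and b: "b = h \<or> b = inv h"
  shows "\<exists>B. \<forall>(m::nat) (n::nat). gromov_product x (\<phi> (a [^] m) x) (\<phi> (b [^] n) x) \<le> B"
proof (rule ccontr)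
  assume no: "\<not> ?thesis"
  have lox: "loxodromic G \<phi> a" "loxodromic G \<phi> b" using assms loxodromic_inv by auto
  define u v where "u = (\<lambda>n::nat. \<phi> (a [^] n) x)" and "v = (\<lambda>n::nat. \<phi> (b [^] n) x)"
  obtain B1 where B1: "coarse_ray B1 u"
    unfolding u_def using loxodromic_coarse_ray[OF lox(1)] by blast
  obtain B2 where B2: "coarse_ray B2 v"
    unfolding v_def using loxodromic_coarse_ray[OF lox(2)] by blast
  have "(u, v) \<in> boundary_rel"
  proof (rule coarse_rays_asymptotic[where B = "max B1 B2"])
    show "coarse_ray (max B1 B2) u" "coarse_ray (max B1 B2) v"
      using B1 B2 unfolding coarse_ray_def by (meson max.coboundedI1 max.coboundedI2)+
    show "u 0 = v 0" by (simp add: u_def v_def)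
    fix K
    have "\<not> (\<forall>m n. gromov_product x (u m) (v n) \<le> K)"
      using no unfolding u_def v_def by blast
    then obtain m n where "\<not> gromov_product x (u m) (v n) \<le> K" by blast
    moreover have "u 0 = x" by (simp add: u_def)
    ultimately show "\<exists>m n. K \<le> gromov_product (u 0) (u m) (v n)"
      by (metis linear)
  qed
  then have "boundary_rel `` {u} = boundary_rel `` {v}" by (rule boundary_class_eq)
  moreover have "boundary_rel `` {u} \<in> boundary_fixed_points (\<phi> g)"
    "boundary_rel `` {v} \<in> boundary_fixed_points (\<phi> h)"
    unfolding u_def v_def
    by (rule power_ray_endpoint_fixed[OF assms(1) a] power_ray_endpoint_fixed[OF assms(2) b])+
  ultimately show False using disj by (metis IntI empty_iff)
qed

text \<open>Translation by \<open>g [^] m\<close> turns this into the product of \<open>x\<close>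
  and \<open>\<phi> (g [^] (m + n)) x\<close> at an intermediate point of a coarse ray.\<close>

lemma loxodromic_opposite_product_bounded:
  assumes "loxodromic G \<phi> g"
  shows "\<exists>B. \<forall>(m::nat) (n::nat). gromov_product x (\<phi> (inv g [^] m) x) (\<phi> (g [^] n) x) \<le> B"
proof -
  have g: "g \<in> carrier G" using assms by (simp add: loxodromic_def)
  obtain B where B: "coarse_ray B (\<lambda>n::nat. \<phi> (g [^] n) x)"
    using loxodromic_coarse_ray[OF assms] by blast
  have "gromov_product x (\<phi> (inv g [^] m) x) (\<phi> (g [^] n) x) \<le> B" for m n :: nat
  proof -
    have gm: "g [^] m \<in> carrier G" using g by simp
    have "gromov_product x (\<phi> (inv g [^] m) x) (\<phi> (g [^] n) x) =
      gromov_product (\<phi> (g [^] m) x) (\<phi> (g [^] m) (\<phi> (inv g [^] m) x)) (\<phi> (g [^] m) (\<phi> (g [^] n) x))"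
      using gm by simp
    also have "\<dots> = gromov_product (\<phi> (g [^] m) x) x (\<phi> (g [^] (m + n)) x)"
      using g gm nat_pow_mult[OF g, of m n] by (simp add: nat_pow_inv flip: act_mult)
    also have "\<dots> \<le> B" using B unfolding coarse_ray_def by (metis act_one le_add1 nat_pow_0)
    finally show ?thesis .
  qed
  then show ?thesis by blast
qed

text \<open>WPD supplies a single exponent \<open>N\<close>. For larger exponents the point of
  exponent \<open>N\<close> is coarsely between the ends, so WPD is applied with a displacement
  enlarged for \<open>coarse_stab_between\<close>.\<close>

lemma WPD_coarse_stab_eventually_finite:
  assumes "loxodromic_WPD G \<phi> g" "c \<ge> 0"
  shows "\<forall>\<^sub>F n in sequentially. finite (coarse_stab c x (\<phi> (g [^] (n::nat)) x))"
proof -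
  have g: "g \<in> carrier G" and lox: "loxodromic G \<phi> g" and wpd: "WPD G \<phi> g"
    using assms(1) by (auto simp: loxodromic_WPD_def loxodromic_def)
  obtain B where B: "coarse_ray B (\<lambda>n::nat. \<phi> (g [^] n) x)"
    using loxodromic_coarse_ray[OF lox] by blast
  have "0 \<le> B" using B by (auto simp: coarse_ray_def dest: spec[of _ 0])
  then have "0 \<le> c + 2 * B + 2 * \<delta>" using assms(2) delta_nonneg by simp
  with wpd obtain N :: nat where N: "finite (coarse_stab (c + 2 * B + 2 * \<delta>) x (\<phi> (g [^] N) x))"
    unfolding WPD_def coarse_stab_def by (subst (asm) (2 3) dist_commute) blast
  have "finite (coarse_stab c x (\<phi> (g [^] n) x))" if "n \<ge> N" for n
  proof (rule finite_subset[OF coarse_stab_between N])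
    show "gromov_product (\<phi> (g [^] N) x) x (\<phi> (g [^] n) x) \<le> B"
      using B that unfolding coarse_ray_def by (metis act_one nat_pow_0)
  qed
  then show ?thesis unfolding eventually_sequentially by blast
qed

text \<open>The products are bounded for all exponents at once, so \<open>B\<close> is fixed first
  and \<open>N\<close> can then be chosen in terms of \<open>B\<close>; raising the exponents does
  not spoil \<open>B\<close>.\<close>

lemma independent_powers_broken_letters:
  assumes I: "finite I" "I \<noteq> {}"
    and lox: "\<And>i. i \<in> I \<Longrightarrow> loxodromic_WPD G \<phi> (h i)"
    and indep: "independent_family \<phi> I h"
  shows "\<exists>B (N::nat). \<forall>d. (\<forall>i\<in>I. d i \<ge> N) \<longrightarrow>
    broken_letters \<delta> G \<phi> x B ((\<lambda>i. h i [^] (d i :: nat)) ` I)"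
proof -
  have lx: "loxodromic G \<phi> (h i)" "h i \<in> carrier G" if "i \<in> I" for i
    using lox[OF that] by (auto simp: loxodromic_WPD_def loxodromic_def)
  define A where "A = I \<times> (UNIV :: bool set)"
  \<comment> \<open>A pair of an index and a sign names one ray. Distinct pairs cover both different
    generators and the two directions of one generator.\<close>
  define r where "r p = (if snd p then h (fst p) else inv (h (fst p)))" for p
  define bounded where "bounded B p q \<longleftrightarrow> p \<noteq> q \<longrightarrow>
    (\<forall>(m::nat) (n::nat). gromov_product x (\<phi> (r p [^] m) x) (\<phi> (r q [^] n) x) \<le> B)" for B p q
  have "\<exists>B. bounded B p q" if pq: "p \<in> A" "q \<in> A" for p q
  proof (cases "fst p = fst q")
    case False
    have "fst p \<in> I" "fst q \<in> I" using pq by (auto simp: A_def)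
    moreover from this have
      "boundary_fixed_points (\<phi> (h (fst p))) \<inter> boundary_fixed_points (\<phi> (h (fst q))) = {}"
      using indep False by (auto simp: independent_family_def)
    ultimately show ?thesis
      unfolding bounded_def
      using independent_powers_product_bounded[of "h (fst p)" "h (fst q)" "r p" "r q" x] lx
      by (auto simp: r_def)
  next
    case True
    have i: "fst p \<in> I" using pq by (auto simp: A_def)
    obtain B where B: "\<And>(m::nat) (n::nat). gromov_product x (\<phi> (inv h (fst p) [^] m) x) (\<phi> (h (fst p) [^] n) x) \<le> B"
      using loxodromic_opposite_product_bounded[OF lx(1)[OF i]] by blast
    have "snd q \<longleftrightarrow> \<not> snd p" if "p \<noteq> q" using that True by (auto simp: prod_eq_iff)
    then have "bounded B p q"
      unfolding bounded_def r_def using B True gromov_product_commute[of x] by (cases "snd p") auto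
    then show ?thesis by blast
  qed
  \<comment> \<open>The property \<open>bounded\<close> is monotone in \<open>B\<close>, so finitely
    many pairs share one bound.\<close>
  then have "\<forall>\<^sub>F B in at_top. bounded B p q" if "p \<in> A" "q \<in> A" for p q
    unfolding eventually_at_top_linorder bounded_def using that by (meson order_trans)
  moreover have "finite A" using I(1) by (simp add: A_def)
  ultimately have "\<forall>\<^sub>F B in at_top. \<forall>p\<in>A. \<forall>q\<in>A. bounded B p q"
    by (simp add: eventually_ball_finite)
  then have "\<forall>\<^sub>F B in at_top. 0 \<le> B \<and> (\<forall>p\<in>A. \<forall>q\<in>A. bounded B p q)"
    using eventually_conj eventually_ge_at_top by blast
  then obtain B where B: "0 \<le> B" "\<And>p q. p \<in> A \<Longrightarrow> q \<in> A \<Longrightarrow> bounded B p q"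
    using eventually_happens'[OF trivial_limit_at_top_linorder] by blast
  define good where "good g n \<longleftrightarrow> 2 * B + 3 * \<delta> + 1 \<le> dist x (\<phi> (g [^] n) x) \<and>
    finite (coarse_stab (2 * B + 10 * \<delta> + 1) x (\<phi> (g [^] n) x))" for g and n :: nat
  have "\<forall>\<^sub>F n in sequentially. \<forall>i\<in>I. good (h i) n"
  proof (rule eventually_ball_finite[OF I(1)], rule ballI)
    fix i assume i: "i \<in> I"
    show "\<forall>\<^sub>F n in sequentially. good (h i) n"
      unfolding good_def
    proof (rule eventually_conj)
      show "\<forall>\<^sub>F n in sequentially. 2 * B + 3 * \<delta> + 1 \<le> dist x (\<phi> (h i [^] (n::nat)) x)"
        using loxodromic_dist_at_top[OF lx(1)[OF i]] by (simp add: filterlim_at_top)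
      show "\<forall>\<^sub>F n in sequentially. finite (coarse_stab (2 * B + 10 * \<delta> + 1) x (\<phi> (h i [^] (n::nat)) x))"
        using B(1) delta_nonneg by (intro WPD_coarse_stab_eventually_finite[OF lox[OF i]]) simp
    qed
  qed
  then obtain N where N: "\<And>n i. n \<ge> N \<Longrightarrow> i \<in> I \<Longrightarrow> good (h i) n"
    unfolding eventually_sequentially by blast
  have "broken_letters \<delta> G \<phi> x B ((\<lambda>i. h i [^] d i) ` I)" if d: "\<forall>i\<in>I. d i \<ge> N" for d
  proof -
    let ?S = "(\<lambda>i. h i [^] d i) ` I"
    have letter: "\<exists>i b. i \<in> I \<and> s = r (i, b) [^] d i" if "s \<in> letters ?S" for s
    proof -
      from that obtain i where "i \<in> I" "s = h i [^] d i \<or> s = inv (h i [^] d i)"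
        by (auto simp: letters_def)
      then have "s = r (i, True) [^] d i \<or> s = r (i, False) [^] d i"
        using lx(2) by (auto simp: r_def nat_pow_inv)
      then show ?thesis using \<open>i \<in> I\<close> by blast
    qed
    have r: "r (i, b) \<in> carrier G" "inv (r (i, b) [^] n) = r (i, \<not> b) [^] n"
      "dist x (\<phi> (r (i, b) [^] n) x) = dist x (\<phi> (h i [^] n) x)" if "i \<in> I" for i b and n :: nat
      using lx(2)[OF that] dist_act_left[of "h i [^] n" x x]
      by (auto simp: r_def nat_pow_inv dist_commute)
    show ?thesis
    proof (intro broken_letters.intro broken_letters_axioms.intro hyperbolic_action_axioms B(1))
      show "finite ?S" "?S \<noteq> {}" "?S \<subseteq> carrier G" using I lx(2) by auto
    next
      fix s assume "s \<in> letters ?S"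
      then obtain i b where s: "i \<in> I" "s = r (i, b) [^] d i" using letter by blast
      show "2 * B + 3 * \<delta> + 1 \<le> dist x (\<phi> s x)"
        using N[of "d i" i] s d r by (simp add: good_def)
      show "s \<otimes> s \<noteq> \<one>"
      proof
        assume "s \<otimes> s = \<one>"
        \<comment> \<open>The square is again a power with exponent at least \<open>N\<close>, and
          \<open>good\<close> gives it positive displacement.\<close>
        then have "dist x (\<phi> (r (i, b) [^] (d i + d i)) x) = 0"
          using r(1)[OF s(1)] s(2) by (simp flip: nat_pow_mult)
        then show False
          using N[of "d i + d i" i] s(1) d B(1) delta_nonneg r(3)[OF s(1)] by (simp add: good_def trans_le_add1)
      qed
      fix t assume "t \<in> letters ?S" and st: "s \<otimes> t \<noteq> \<one>"
      then obtain j b' where t: "j \<in> I" "t = r (j, b') [^] d j" using letter by blast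
      \<comment> \<open>Seen from \<open>x\<close>, the corner compares the rays of
        \<open>inv s\<close> and \<open>t\<close>; they coincide only if \<open>t\<close> cancels
        \<open>s\<close>.\<close>
      have "(i, \<not> b) \<noteq> (j, b')"
      proof
        assume "(i, \<not> b) = (j, b')"
        then have "t = inv s" using s t r(2) by auto
        then show False using st s r(1) by simp
      qed
      moreover have "inv s = r (i, \<not> b) [^] d i" using s r(2) by simp
      ultimately show "gromov_product x (\<phi> (inv s) x) (\<phi> t x) \<le> B"
        using B(2)[of "(i, \<not> b)" "(j, b')"] s(1) t by (simp add: bounded_def A_def)
    next
      fix s assume "s \<in> ?S"
      then show "finite (coarse_stab (2 * B + 10 * \<delta> + 1) x (\<phi> s x))"
        using N d by (auto simp: good_def)
    qed
  qed
  then show ?thesis by blast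
qed

end

theorem corollary4p8:
  fixes G :: "('g, 'm) monoid_scheme"
    and \<phi> :: "'g \<Rightarrow> 'x::metric_space \<Rightarrow> 'x"
    and h :: "nat \<Rightarrow> 'g"
    and k :: nat
  assumes "group G"
    and "hyperbolic_space TYPE('x)"
    and "isometric_action G \<phi>"
    and "k \<ge> 1"
    and "\<And>i. i \<in> {1..k} \<Longrightarrow> loxodromic_WPD G \<phi> (h i)"
    and "independent_family \<phi> {1..k} h"
  shows "\<exists>D::int. D \<ge> 1 \<and>
    (\<forall>d :: nat \<Rightarrow> int. (\<forall>i\<in>{1..k}. d i \<ge> D) \<longrightarrow>
      (let H = generate G ((\<lambda>i. h i [^]\<^bsub>G\<^esub> d i) ` {1..k}) in
        AQI_triple G \<phi> H \<and>
        (\<forall>g\<in>H. g \<noteq> \<one>\<^bsub>G\<^esub> \<longrightarrow> loxodromic_WPD G \<phi> g)))"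
proof -
  obtain \<delta> :: real where "\<delta> \<ge> 0" "\<And>w x y z :: 'x.
      gromov_product w x z \<ge> min (gromov_product w x y) (gromov_product w y z) - \<delta>"
    using assms(2) unfolding hyperbolic_space_def gromov_hyperbolic_def by blast
  then interpret hyperbolic_action "TYPE('x)" \<delta> G \<phi>
    using assms(1,3) by (simp add: hyperbolic_action_def hyperbolic_action_axioms_def delta_hyperbolic_def)
  \<comment> \<open>Any base point will do; \<open>undefined\<close> names one.\<close>
  obtain B and N :: nat where BN: "\<And>e :: nat \<Rightarrow> nat. \<forall>i\<in>{1..k}. e i \<ge> N \<Longrightarrow>
      broken_letters \<delta> G \<phi> undefined B ((\<lambda>i. h i [^]\<^bsub>G\<^esub> e i) ` {1..k})"
    using independent_powers_broken_letters[of "{1..k}" h undefined] assms(4-6) by auto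
  show ?thesis
  \<comment> \<open>The successor secures \<open>D \<ge> 1\<close>, and the integer exponents, being
    positive, convert to natural ones.\<close>
  proof (intro exI[of _ "int (Suc N)"] conjI allI impI)
    fix d :: "nat \<Rightarrow> int" assume d: "\<forall>i\<in>{1..k}. d i \<ge> int (Suc N)"
    then have gens: "(\<lambda>i. h i [^]\<^bsub>G\<^esub> d i) ` {1..k} = (\<lambda>i. h i [^]\<^bsub>G\<^esub> nat (d i)) ` {1..k}"
      by (intro image_cong refl pow_nat[symmetric]) (meson of_nat_0_le_iff order_trans)
    interpret L: broken_letters "TYPE('x)" \<delta> G \<phi> undefined B "(\<lambda>i. h i [^]\<^bsub>G\<^esub> nat (d i)) ` {1..k}"
      using d by (intro BN) auto
    show "let H = generate G ((\<lambda>i. h i [^]\<^bsub>G\<^esub> d i) ` {1..k}) in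
        AQI_triple G \<phi> H \<and>
        (\<forall>g\<in>H. g \<noteq> \<one>\<^bsub>G\<^esub> \<longrightarrow> loxodromic_WPD G \<phi> g)"
      unfolding Let_def gens using L.H_AQI_triple[OF assms(2)] L.H_loxodromic_WPD by blast
  qed simp
qed

end
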